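(* Let $\gamma$ be a positive $n$-braid word and let $\mathfrak w:\gamma\to\Delta$ be a weave with no caps, $a$ cups and $b$ trivalent vertices, $a,b\in\mathbb{N}$. Then the correspondence $\mathcal M(\mathfrak w,w_0)$ yields an injective map $$\mathbb{C}^a\times(\mathbb{C}^* )^b\hookrightarrow X_0(\gamma;w_0),\qquad 2a+b=\ell(\gamma)-\binom{n}{2}.$$
   Context: All varieties are over $\mathbb{C}$. A positive $n$-braid word is a finite sequence $\beta=\sigma_{i_1}\cdots\sigma_{i_\ell}$, $i_k\in[1,n-1]$, $\ell(\beta)=\ell$. $B_i(z)$ is the identity $n\times n$ matrix except for the $2\times2$ block $\begin{pmatrix}0&1\\1&z\end{pmatrix}$ in rows and columns $i,i+1$; $B_\beta(z)=B_{i_1}(z_1)\cdots B_{i_\ell}(z_\ell)$. Permutations are viewed as permutation matrices with $s_i\mapsto B_i(0)$; $w_0\in S_n$ is the longest element; $\Delta=(\sigma_1\cdots\sigma_{n-1})(\sigma_1\cdots\sigma_{n-2})\cdots(\sigma_1\sigma_2)\sigma_1$. $X_0(\beta;\pi)=\{z\in\mathbb{C}^\ell: B_\beta(z)\pi\text{ upper-triangular}\}$. A weave $\mathfrak w:\beta_2\to\beta_1$ is a finite sequence of words $\beta_2=\gamma_0\to\cdots\to\gamma_m=\beta_1$, each step applying one elementary move to consecutive letters at a specified position: trivalent vertex $\sigma_i\sigma_i\to\sigma_i$; 6-valent vertex $\sigma_i\sigma_{i+1}\sigma_i\leftrightarrow\sigma_{i+1}\sigma_i\sigma_{i+1}$;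 4-valent vertex $\sigma_i\sigma_j\to\sigma_j\sigma_i$ ($|i-j|>1$); cup $\sigma_i\sigma_i\to1$; cap $1\to\sigma_i\sigma_i$. $\mathcal M(\mathfrak w)$ is the variety of the following data: vectors $z^{(j)}\in\mathbb{C}^{\ell(\gamma_j)}$ for all $j$, and, for each step $\gamma_j\to\gamma_{j+1}$ that is a trivalent vertex, cup or cap with exactly $p$ letters to the left of the move, invertible upper-triangular matrices $U_0,\dots,U_p$; such that, if the step replaces the subword $u$ by $v$: variables of letters to the right of the move are unchanged; for a 4- or 6-valent vertex, $B_u=B_v$ (evaluated at the corresponding entries of $z^{(j)},z^{(j+1)}$) and the variables to the left are unchanged; for a trivalent vertex, cup or cap, $B_u=U_pB_v$ (the empty word gives the identity) and $B_{i_q}(z_q^{(j)})U_q=U_{q-1}B_{i_q}(z_q^{(j+1)})$ for $q=p,\dots,1$, $i_q$ being the index of the $q$-th letter. $\mathcal M(\mathfrak w,w_0)\subseteq\mathcal M(\mathfrak w)$ is the closed subvariety where $B_{\beta_1}(z^{(m)})w_0$ is upper-triangular; it maps to $X_0(\beta_1;w_0)$ by $z^{(m)}$ and to $X_0(\beta_2;w_0)$ by $z^{(0)}$. The assertion is that $\mathcal M(\mathfrak w,w_0)$ is isomorphic to $\mathbb{C}^a\times(\mathbb{C}^* )^b$ and that its map to $X_0(\gamma;w_0)$ is the injective map in question. *)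

theory Defs
  imports Complex_Main "HOL-Combinatorics.Permutations" "Jordan_Normal_Form.Matrix"
begin

section \<open>Embedded varieties and regular maps\<close>

text \<open>
  A (quasi-affine) variety over the complex numbers is given by its set of points together with
  the coordinate functions of the affine space in which it is embedded. A function is regular if
  it is locally, in the Zariski topology, a quotient of polynomials in the coordinates; since the
  principal open sets form a basis, the neighbourhood can be taken to be the locus where the
  denominator does not vanish.
\<close>

record 'p variety =
  points :: "'p set"
  coords :: "('p \<Rightarrow> complex) set"

inductive_set polynomial_functions :: "('p \<Rightarrow> complex) set \<Rightarrow> ('p \<Rightarrow> complex) set"
  for C :: "('p \<Rightarrow> complex) set"
where
  const: "(\<lambda>_. c) \<in> polynomial_functions C"
| coord: "f \<in> C \<Longrightarrow> f \<in> polynomial_functions C"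
| add: "f \<in> polynomial_functions C \<Longrightarrow> g \<in> polynomial_functions C \<Longrightarrow>
    (\<lambda>x. f x + g x) \<in> polynomial_functions C"
| mult: "f \<in> polynomial_functions C \<Longrightarrow> g \<in> polynomial_functions C \<Longrightarrow>
    (\<lambda>x. f x * g x) \<in> polynomial_functions C"

definition regular_function :: "('p, 'x) variety_scheme \<Rightarrow> ('p \<Rightarrow> complex) \<Rightarrow> bool" where
  "regular_function V f \<longleftrightarrow>
    (\<forall>x \<in> points V. \<exists>g \<in> polynomial_functions (coords V). \<exists>h \<in> polynomial_functions (coords V).
       h x \<noteq> 0 \<and> (\<forall>y \<in> points V. h y \<noteq> 0 \<longrightarrow> f y = g y / h y))"

definition regular_map ::
  "('p, 'x) variety_scheme \<Rightarrow> ('q, 'y) variety_scheme \<Rightarrow> ('p \<Rightarrow> 'q) \<Rightarrow> bool" where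
  "regular_map V W f \<longleftrightarrow>
    f ` points V \<subseteq> points W \<and> (\<forall>c \<in> coords W. regular_function V (c \<circ> f))"

definition variety_iso ::
  "('p, 'x) variety_scheme \<Rightarrow> ('q, 'y) variety_scheme \<Rightarrow> ('p \<Rightarrow> 'q) \<Rightarrow> bool" where
  "variety_iso V W f \<longleftrightarrow>
    regular_map V W f \<and>
    (\<exists>g. regular_map W V g \<and> (\<forall>x \<in> points V. g (f x) = x) \<and> (\<forall>y \<in> points W. f (g y) = y))"

text \<open>
  The complex affine space of dimension \<open>k\<close> consists of the lists of length \<open>k\<close>. The following
  is the product of the affine space of dimension \<open>a\<close> and the torus of dimension \<open>b\<close>.
\<close>

definition affine_torus :: "nat \<Rightarrow> nat \<Rightarrow> (complex list \<times> complex list) variety" where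
  "affine_torus a b =
    \<lparr> points = {(s, t). length s = a \<and> length t = b \<and> (\<forall>k < b. t ! k \<noteq> 0)},
      coords = {\<lambda>(s, t). s ! k | k. k < a} \<union> {\<lambda>(s, t). t ! k | k. k < b} \<rparr>"


section \<open>Braid words, braid matrices and permutation matrices\<close>

text \<open>
  The letter \<open>\<sigma>\<^sub>i\<close> is represented by \<open>i\<close>, with \<open>1 \<le> i < n\<close>. Matrix rows and columns are numbered
  from \<open>0\<close>, so the \<open>2 \<times> 2\<close> block of the \<open>i\<close>-th braid matrix occupies positions \<open>i - 1\<close> and \<open>i\<close>.
\<close>

definition braid_word :: "nat \<Rightarrow> nat list \<Rightarrow> bool" where
  "braid_word n \<beta> \<longleftrightarrow> (\<forall>i \<in> set \<beta>. 1 \<le> i \<and> i < n)"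

definition braid_gen :: "nat \<Rightarrow> nat \<Rightarrow> complex \<Rightarrow> complex mat" where
  "braid_gen n i z = mat n n (\<lambda>(r, c).
     if r = i - 1 \<and> c = i - 1 then 0
     else if r = i - 1 \<and> c = i then 1
     else if r = i \<and> c = i - 1 then 1
     else if r = i \<and> c = i then z
     else if r = c then 1 else 0)"

definition braid_mat :: "nat \<Rightarrow> nat list \<Rightarrow> complex list \<Rightarrow> complex mat" where
  "braid_mat n \<beta> z = foldr (\<lambda>(i, x) A. braid_gen n i x * A) (zip \<beta> z) (1\<^sub>m n)"

text \<open>The word \<open>(\<sigma>\<^sub>1 \<dots> \<sigma>\<^bsub>n-1\<^esub>) (\<sigma>\<^sub>1 \<dots> \<sigma>\<^bsub>n-2\<^esub>) \<dots> (\<sigma>\<^sub>1 \<sigma>\<^sub>2) \<sigma>\<^sub>1\<close>.\<close>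

definition half_twist :: "nat \<Rightarrow> nat list" where
  "half_twist n = concat (map (\<lambda>k. [1..<Suc k]) (rev [1..<n]))"

lemma "half_twist 4 = [1, 2, 3, 1, 2, 1]"
  by (simp add: half_twist_def upt_rec)

text \<open>Permutations act on \<open>{..<n}\<close>; the transposition \<open>s\<^sub>i\<close> exchanges \<open>i - 1\<close> and \<open>i\<close>.\<close>

definition perm_mat :: "nat \<Rightarrow> (nat \<Rightarrow> nat) \<Rightarrow> complex mat" where
  "perm_mat n \<pi> = mat n n (\<lambda>(r, c). if r = \<pi> c then 1 else 0)"

lemma perm_mat_simple_transposition:
  assumes "1 \<le> i" "i < n"
  shows "perm_mat n (transpose (i - 1) i) = braid_gen n i 0"
  using assms by (intro eq_matI) (auto simp: perm_mat_def braid_gen_def transpose_def)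

lemma perm_mat_comp:
  assumes "\<pi> permutes {..<n}" "\<rho> permutes {..<n}"
  shows "perm_mat n (\<pi> \<circ> \<rho>) = perm_mat n \<pi> * perm_mat n \<rho>"
proof (intro eq_matI)
  fix r c assume "r < dim_row (perm_mat n \<pi> * perm_mat n \<rho>)"
    and "c < dim_col (perm_mat n \<pi> * perm_mat n \<rho>)"
  then have rc: "r < n" "c < n" by (auto simp: perm_mat_def)
  have \<rho>c: "\<rho> c < n" using assms(2) rc(2) permutes_in_image by fastforce
  have "(perm_mat n \<pi> * perm_mat n \<rho>) $$ (r, c) =
      (\<Sum>k = 0..<n. (if r = \<pi> k then 1 else 0) * (if k = \<rho> c then 1 else 0))"
    using rc by (simp add: perm_mat_def scalar_prod_def)
  also have "\<dots> = (\<Sum>k = 0..<n. if k = \<rho> c then (if r = \<pi> k then 1 else 0) else 0)"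
    by (intro sum.cong) auto
  also have "\<dots> = (if r = \<pi> (\<rho> c) then 1 else 0)" using \<rho>c by simp
  finally show "perm_mat n (\<pi> \<circ> \<rho>) $$ (r, c) = (perm_mat n \<pi> * perm_mat n \<rho>) $$ (r, c)"
    using rc by (simp add: perm_mat_def)
qed (auto simp: perm_mat_def)

text \<open>The element \<open>w\<^sub>0\<close>; the lemma below confirms that it is the one with most inversions.\<close>

definition longest_perm :: "nat \<Rightarrow> nat \<Rightarrow> nat" where
  "longest_perm n = (\<lambda>i. if i < n then n - 1 - i else i)"

definition perm_length :: "nat \<Rightarrow> (nat \<Rightarrow> nat) \<Rightarrow> nat" where
  "perm_length n \<pi> = card {(i, j). i < j \<and> j < n \<and> \<pi> j < \<pi> i}"

lemma longest_perm_permutes: "longest_perm n permutes {..<n}"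
proof (rule bij_imp_permutes)
  show "bij_betw (longest_perm n) {..<n} {..<n}"
    by (rule bij_betw_byWitness[where f' = "longest_perm n"]) (auto simp: longest_perm_def)
qed (auto simp: longest_perm_def)

lemma longest_perm_longest:
  assumes "\<pi> permutes {..<n}" "\<pi> \<noteq> longest_perm n"
  shows "perm_length n \<pi> < perm_length n (longest_perm n)"
proof -
  let ?I = "\<lambda>\<rho> :: nat \<Rightarrow> nat. {(i, j). i < j \<and> j < n \<and> \<rho> j < \<rho> i}"
  have w0: "?I (longest_perm n) = {(i, j). i < j \<and> j < n}" by (auto simp: longest_perm_def)
  have fin: "finite (?I (longest_perm n))"
    by (rule finite_subset[of _ "{..<n} \<times> {..<n}"]) auto
  have "?I \<pi> \<noteq> ?I (longest_perm n)"
  proof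
    assume "?I \<pi> = ?I (longest_perm n)"
    then have dec: "\<pi> j < \<pi> i" if "i < j" "j < n" for i j using w0 that by blast
    have lt: "\<pi> i < n" if "i < n" for i using assms(1) that permutes_in_image by fastforce
    have up: "\<pi> i + i \<le> n - 1" if "i < n" for i using that
    proof (induction i)
      case 0 then show ?case using lt[of 0] by simp
    next
      case (Suc i) then show ?case using dec[of i "Suc i"] by simp
    qed
    have lo: "k \<le> \<pi> (n - 1 - k)" if "k < n" for k using that
    proof (induction k)
      case 0 then show ?case by simp
    next
      case (Suc k)
      then have "\<pi> (n - 1 - k) < \<pi> (n - 1 - Suc k)" by (intro dec) auto
      with Suc show ?case by simp
    qed
    have "\<pi> i = longest_perm n i" for i
    proof (cases "i < n")
      case True
      then show ?thesis using up[of i] lo[of "n - 1 - i"] by (simp add: longest_perm_def)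
    next
      case False
      then show ?thesis using assms(1) permutes_not_in by (fastforce simp: longest_perm_def)
    qed
    then show False using assms(2) by blast
  qed
  then have "?I \<pi> \<subset> ?I (longest_perm n)" using w0 by auto
  then show ?thesis unfolding perm_length_def by (rule psubset_card_mono[OF fin])
qed

definition braid_variety :: "nat \<Rightarrow> nat list \<Rightarrow> (nat \<Rightarrow> nat) \<Rightarrow> complex list variety" where
  "braid_variety n \<beta> \<pi> =
    \<lparr> points = {z. length z = length \<beta> \<and> upper_triangular (braid_mat n \<beta> z * perm_mat n \<pi>)},
      coords = {\<lambda>z. z ! k | k. k < length \<beta>} \<rparr>"


section \<open>Weaves\<close>

datatype move =
    is_Trivalent: Trivalent nat
  | Six nat nat
  | Four nat nat
  | is_Cup: Cup nat
  | is_Cap: Cap nat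

fun move_source :: "move \<Rightarrow> nat list" where
  "move_source (Trivalent i) = [i, i]"
| "move_source (Six i j) = [i, j, i]"
| "move_source (Four i j) = [i, j]"
| "move_source (Cup i) = [i, i]"
| "move_source (Cap i) = []"

fun move_target :: "move \<Rightarrow> nat list" where
  "move_target (Trivalent i) = [i]"
| "move_target (Six i j) = [j, i, j]"
| "move_target (Four i j) = [j, i]"
| "move_target (Cup i) = []"
| "move_target (Cap i) = [i, i]"

fun valid_move :: "move \<Rightarrow> bool" where
  "valid_move (Six i j) \<longleftrightarrow> j = i + 1 \<or> i = j + 1"
| "valid_move (Four i j) \<longleftrightarrow> i + 1 < j \<or> j + 1 < i"
| "valid_move _ \<longleftrightarrow> True"

text \<open>A step \<open>(p, v)\<close> applies the move \<open>v\<close> with exactly \<open>p\<close> letters to its left.\<close>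

record weave =
  words :: "nat list list"
  steps :: "(nat \<times> move) list"

definition is_step :: "nat list \<Rightarrow> nat \<times> move \<Rightarrow> nat list \<Rightarrow> bool" where
  "is_step \<gamma> s \<gamma>' \<longleftrightarrow>
    (case s of (p, v) \<Rightarrow> valid_move v \<and>
      (\<exists>l r. length l = p \<and> \<gamma> = l @ move_source v @ r \<and> \<gamma>' = l @ move_target v @ r))"

definition is_weave :: "nat \<Rightarrow> nat list \<Rightarrow> nat list \<Rightarrow> weave \<Rightarrow> bool" where
  "is_weave n \<beta>\<^sub>2 \<beta>\<^sub>1 w \<longleftrightarrow>
    length (words w) = Suc (length (steps w)) \<and>
    (\<forall>\<gamma> \<in> set (words w). braid_word n \<gamma>) \<and>
    words w ! 0 = \<beta>\<^sub>2 \<and> words w ! length (steps w) = \<beta>\<^sub>1 \<and>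
    (\<forall>j < length (steps w). is_step (words w ! j) (steps w ! j) (words w ! Suc j))"

definition num_trivalent :: "weave \<Rightarrow> nat" where
  "num_trivalent w = length (filter (\<lambda>(p, v). is_Trivalent v) (steps w))"

definition num_cups :: "weave \<Rightarrow> nat" where
  "num_cups w = length (filter (\<lambda>(p, v). is_Cup v) (steps w))"

definition num_caps :: "weave \<Rightarrow> nat" where
  "num_caps w = length (filter (\<lambda>(p, v). is_Cap v) (steps w))"


section \<open>The correspondence of a weave\<close>

definition borel_subgroup :: "nat \<Rightarrow> complex mat set" where
  "borel_subgroup n = {U \<in> carrier_mat n n. upper_triangular U \<and> invertible_mat U}"

definition num_matrices :: "nat \<times> move \<Rightarrow> nat" where
  "num_matrices s =
    (case s of (p, v) \<Rightarrow> if is_Trivalent v \<or> is_Cup v \<or> is_Cap v then Suc p else 0)"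

text \<open>
  The conditions on the variables \<open>z\<close>, \<open>z'\<close> before and after a step out of the word \<open>\<gamma>\<close>. As lists
  are numbered from \<open>0\<close>, the letter \<open>i\<^sub>q\<close> and its variables have position \<open>q - 1\<close>.
\<close>

definition step_relation ::
  "nat \<Rightarrow> nat list \<Rightarrow> nat \<times> move \<Rightarrow> complex list \<Rightarrow> complex list \<Rightarrow> complex mat list \<Rightarrow> bool" where
  "step_relation n \<gamma> s z z' U \<longleftrightarrow>
    (case s of (p, v) \<Rightarrow>
      let u = move_source v; u' = move_target v;
          A = braid_mat n u (take (length u) (drop p z));
          A' = braid_mat n u' (take (length u') (drop p z'))
      in drop (p + length u) z = drop (p + length u') z' \<and>
         length U = num_matrices s \<and> set U \<subseteq> borel_subgroup n \<and>
         (if is_Trivalent v \<or> is_Cup v \<or> is_Cap v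
          then A = U ! p * A' \<and>
            (\<forall>q \<in> {1..p}. braid_gen n (\<gamma> ! (q - 1)) (z ! (q - 1)) * U ! q =
               U ! (q - 1) * braid_gen n (\<gamma> ! (q - 1)) (z' ! (q - 1)))
          else A = A' \<and> take p z = take p z'))"

text \<open>
  A point consists of the vectors \<open>z\<^bsup>(0)\<^esup>, \<dots>, z\<^bsup>(m)\<^esup>\<close> and of the list of matrices of every step
  (empty for the 4- and 6-valent vertices).
\<close>

type_synonym weave_data = "complex list list \<times> complex mat list list"

definition correspondence_points :: "nat \<Rightarrow> weave \<Rightarrow> weave_data set" where
  "correspondence_points n w = {(zs, Us).
     length zs = length (words w) \<and>
     (\<forall>j < length (words w). length (zs ! j) = length (words w ! j)) \<and>
     length Us = length (steps w) \<and>
     (\<forall>j < length (steps w).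
        step_relation n (words w ! j) (steps w ! j) (zs ! j) (zs ! Suc j) (Us ! j))}"

definition correspondence_coords :: "nat \<Rightarrow> weave \<Rightarrow> (weave_data \<Rightarrow> complex) set" where
  "correspondence_coords n w =
     {\<lambda>(zs, Us). zs ! j ! k | j k. j < length (words w) \<and> k < length (words w ! j)} \<union>
     {\<lambda>(zs, Us). (Us ! j ! q) $$ (r, c) | j q r c.
        j < length (steps w) \<and> q < num_matrices (steps w ! j) \<and> r < n \<and> c < n}"

definition correspondence :: "nat \<Rightarrow> weave \<Rightarrow> weave_data variety" where
  "correspondence n w =
    \<lparr> points = correspondence_points n w, coords = correspondence_coords n w \<rparr>"

definition source_map :: "weave_data \<Rightarrow> complex list" where
  "source_map = (\<lambda>(zs, Us). zs ! 0)"

definition target_map :: "weave \<Rightarrow> weave_data \<Rightarrow> complex list" where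
  "target_map w = (\<lambda>(zs, Us). zs ! length (steps w))"

definition closed_correspondence ::
  "nat \<Rightarrow> weave \<Rightarrow> (nat \<Rightarrow> nat) \<Rightarrow> weave_data variety" where
  "closed_correspondence n w \<pi> =
    \<lparr> points = {P \<in> points (correspondence n w).
        upper_triangular
          (braid_mat n (words w ! length (steps w)) (target_map w P) * perm_mat n \<pi>)},
      coords = coords (correspondence n w) \<rparr>"

end

theory Submission
  imports Defs "Jordan_Normal_Form.Determinant"
begin

text \<open>
  A weave without caps can be solved backwards. Suppose that the variables after a step are known. At
  a 4- or 6-valent vertex, the equation \<open>B\<^sub>u = B\<^sub>v\<close> gives the variables before the step as polynomials in
  them. At a trivalent vertex, \<open>B\<^sub>i(a) B\<^sub>i(b) B\<^sub>i(c)\<^sup>-\<^sup>1\<close> is triangular if and only if \<open>a (c - b) = 1\<close>, so that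
  \<open>a\<close> is an arbitrary nonzero number and \<open>b = c - 1 / a\<close>. At a cup, \<open>B\<^sub>i(a) B\<^sub>i(b)\<close> is triangular if and
  only if \<open>a = 0\<close>, so that \<open>b\<close> is an arbitrary number. In the last two cases an invertible triangular
  matrix \<open>U\<close> is sent to the left. To pass the letter \<open>i\<close> it has to turn the variable \<open>x\<close> into a variable
  \<open>x'\<close> such that \<open>B\<^sub>i(x) U B\<^sub>i(x')\<^sup>-\<^sup>1\<close> is again triangular. If the diagonal block of \<open>U\<close> at this letter
  has diagonal entries \<open>p\<close>, \<open>q\<close> and upper right entry \<open>t\<close>, this is the equation \<open>p x' = t + q x\<close>
  (\<open>slide_mat_borel_iff\<close>). As \<open>p\<close> and \<open>q\<close> are nonzero, each of \<open>x\<close> and \<open>x'\<close> determines the other.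

  Hence every cup multiplies the correspondence by a line, every trivalent vertex multiplies it by a punctured
  line, and the other vertices do not change it, up to isomorphism of varieties. By induction on the
  number of steps, the closed correspondence of any weave without caps is the product of the
  braid variety of its target word with an affine space and a torus (\<open>closed_correspondence_isomorphic\<close>).
  For the target \<open>\<Delta>\<close> and the permutation \<open>w\<^sub>0\<close> the braid variety is the single point \<open>0\<close>
  (\<open>points_braid_variety_half_twist\<close>): the conditions that \<open>B\<^sub>\<Delta>(z) w\<^sub>0\<close> is triangular kill the variables
  of one staircase \<open>\<sigma>\<^sub>1 \<dots> \<sigma>\<^sub>k\<close> after the other.

  The same equations are also deterministic in the forward direction: the variables before a step determine
  the parameter, the matrices and the variables after the step. So a point of the correspondence is
  determined by its source (\<open>inj_on_source_map\<close>). The source lies in the braid variety because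
  each step changes the braid matrix by a triangular factor on the left. The dimension formula holds
  because a cup removes two letters, a trivalent vertex removes one, and \<open>\<Delta>\<close> has \<open>n (n - 1) / 2\<close> of them.
\<close>

section \<open>Regular functions\<close>

lemma regular_functionI:
  assumes "\<And>x. x \<in> points V \<Longrightarrow> \<exists>g \<in> polynomial_functions (coords V).
     \<exists>h \<in> polynomial_functions (coords V). h x \<noteq> 0 \<and> (\<forall>y \<in> points V. h y \<noteq> 0 \<longrightarrow> f y = g y / h y)"
  shows "regular_function V f"
  using assms by (auto simp: regular_function_def)

lemma regular_functionE:
  assumes "regular_function V f" "x \<in> points V"
  obtains g h where "g \<in> polynomial_functions (coords V)" "h \<in> polynomial_functions (coords V)"
    "h x \<noteq> 0" "\<And>y. y \<in> points V \<Longrightarrow> h y \<noteq> 0 \<Longrightarrow> f y = g y / h y"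
  using assms unfolding regular_function_def by blast

lemma regular_function_cong:
  assumes "\<And>x. x \<in> points V \<Longrightarrow> f x = g x"
  shows "regular_function V f \<longleftrightarrow> regular_function V g"
  using assms by (simp add: regular_function_def)

lemma regular_function_polynomial:
  assumes "f \<in> polynomial_functions (coords V)"
  shows "regular_function V f"
  by (rule regular_functionI, rule bexI[OF _ assms], rule bexI[of _ "\<lambda>_. 1"])
    (auto intro: polynomial_functions.const)

lemma regular_function_const: "regular_function V (\<lambda>_. c)"
  by (intro regular_function_polynomial polynomial_functions.const)

lemma regular_function_coord: "c \<in> coords V \<Longrightarrow> regular_function V c"
  by (intro regular_function_polynomial polynomial_functions.coord)

lemma regular_function_add:
  assumes "regular_function V f" "regular_function V g"
  shows "regular_function V (\<lambda>x. f x + g x)"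
proof (rule regular_functionI)
  fix x assume x: "x \<in> points V"
  obtain p q where f: "p \<in> polynomial_functions (coords V)" "q \<in> polynomial_functions (coords V)"
    "q x \<noteq> 0" "\<And>y. y \<in> points V \<Longrightarrow> q y \<noteq> 0 \<Longrightarrow> f y = p y / q y"
    using regular_functionE[OF assms(1) x] by blast
  obtain r s where g: "r \<in> polynomial_functions (coords V)" "s \<in> polynomial_functions (coords V)"
    "s x \<noteq> 0" "\<And>y. y \<in> points V \<Longrightarrow> s y \<noteq> 0 \<Longrightarrow> g y = r y / s y"
    using regular_functionE[OF assms(2) x] by blast
  show "\<exists>a \<in> polynomial_functions (coords V). \<exists>b \<in> polynomial_functions (coords V).
      b x \<noteq> 0 \<and> (\<forall>y \<in> points V. b y \<noteq> 0 \<longrightarrow> f y + g y = a y / b y)"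
    using f g
    by (intro bexI[of _ "\<lambda>y. p y * s y + r y * q y"] bexI[of _ "\<lambda>y. q y * s y"]
        polynomial_functions.add polynomial_functions.mult) (auto simp: field_simps)
qed

lemma regular_function_mult:
  assumes "regular_function V f" "regular_function V g"
  shows "regular_function V (\<lambda>x. f x * g x)"
proof (rule regular_functionI)
  fix x assume x: "x \<in> points V"
  obtain p q where f: "p \<in> polynomial_functions (coords V)" "q \<in> polynomial_functions (coords V)"
    "q x \<noteq> 0" "\<And>y. y \<in> points V \<Longrightarrow> q y \<noteq> 0 \<Longrightarrow> f y = p y / q y"
    using regular_functionE[OF assms(1) x] by blast
  obtain r s where g: "r \<in> polynomial_functions (coords V)" "s \<in> polynomial_functions (coords V)"
    "s x \<noteq> 0" "\<And>y. y \<in> points V \<Longrightarrow> s y \<noteq> 0 \<Longrightarrow> g y = r y / s y"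
    using regular_functionE[OF assms(2) x] by blast
  show "\<exists>a \<in> polynomial_functions (coords V). \<exists>b \<in> polynomial_functions (coords V).
      b x \<noteq> 0 \<and> (\<forall>y \<in> points V. b y \<noteq> 0 \<longrightarrow> f y * g y = a y / b y)"
    using f g
    by (intro bexI[of _ "\<lambda>y. p y * r y"] bexI[of _ "\<lambda>y. q y * s y"] polynomial_functions.mult) auto
qed

lemma regular_function_inverse:
  assumes "regular_function V f" "\<And>x. x \<in> points V \<Longrightarrow> f x \<noteq> 0"
  shows "regular_function V (\<lambda>x. 1 / f x)"
proof (rule regular_functionI)
  fix x assume x: "x \<in> points V"
  obtain p q where f: "p \<in> polynomial_functions (coords V)" "q \<in> polynomial_functions (coords V)"
    "q x \<noteq> 0" "\<And>y. y \<in> points V \<Longrightarrow> q y \<noteq> 0 \<Longrightarrow> f y = p y / q y"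
    using regular_functionE[OF assms(1) x] by blast
  have "p x \<noteq> 0" using f(3) f(4)[OF x] assms(2)[OF x] by auto
  \<comment> \<open>The factor \<open>q\<close> is kept in the denominator, as nothing is known where \<open>q\<close> vanishes.\<close>
  with f show "\<exists>a \<in> polynomial_functions (coords V). \<exists>b \<in> polynomial_functions (coords V).
      b x \<noteq> 0 \<and> (\<forall>y \<in> points V. b y \<noteq> 0 \<longrightarrow> 1 / f y = a y / b y)"
    by (intro bexI[of _ "\<lambda>y. q y * q y"] bexI[of _ "\<lambda>y. p y * q y"] polynomial_functions.mult) auto
qed

lemma regular_function_divide:
  assumes "regular_function V f" "regular_function V g" "\<And>x. x \<in> points V \<Longrightarrow> g x \<noteq> 0"
  shows "regular_function V (\<lambda>x. f x / g x)"
  using regular_function_mult[OF assms(1) regular_function_inverse[OF assms(2,3)]] by simp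

lemma regular_function_diff:
  assumes "regular_function V f" "regular_function V g"
  shows "regular_function V (\<lambda>x. f x - g x)"
  using regular_function_add[OF assms(1)
      regular_function_mult[OF regular_function_const[of V "- 1"] assms(2)]] by simp

lemma regular_function_sum:
  assumes "\<And>k. k \<in> A \<Longrightarrow> regular_function V (f k)"
  shows "regular_function V (\<lambda>x. \<Sum>k\<in>A. f k x)"
  using assms
proof (induction A rule: infinite_finite_induct)
  case (insert k A)
  then show ?case by (simp add: regular_function_add)
qed (simp_all add: regular_function_const)

lemma regular_function_if:
  assumes "regular_function V f" "regular_function V g"
  shows "regular_function V (\<lambda>x. if P then f x else g x)"
  using assms by (cases P) simp_all

lemmas regular_function_intros = regular_function_const regular_function_add
  regular_function_mult regular_function_diff

text \<open>
  Substitution turns polynomials into regular functions by structural induction. A local quotient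
  \<open>p / q\<close> therefore becomes a quotient of two regular functions, each of which has a quotient
  representation near the given point; the denominators of all of them are multiplied together.
\<close>

lemma regular_function_comp:
  assumes f: "regular_map V W f" and g: "regular_function W g"
  shows "regular_function V (g \<circ> f)"
proof (rule regular_functionI)
  have poly: "regular_function V (p \<circ> f)" if "p \<in> polynomial_functions (coords W)" for p
    using that
  proof induction
    case (coord c)
    then show ?case using f unfolding regular_map_def by blast
  qed (auto simp: o_def intro: regular_function_intros)
  fix x assume x: "x \<in> points V"
  have fW: "f y \<in> points W" if "y \<in> points V" for y using f that by (auto simp: regular_map_def)
  obtain p q where pq: "p \<in> polynomial_functions (coords W)" "q \<in> polynomial_functions (coords W)"
    "q (f x) \<noteq> 0" "\<And>y. y \<in> points W \<Longrightarrow> q y \<noteq> 0 \<Longrightarrow> g y = p y / q y"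
    using regular_functionE[OF g fW[OF x]] by blast
  obtain p1 p2 where p: "p1 \<in> polynomial_functions (coords V)" "p2 \<in> polynomial_functions (coords V)"
    "p2 x \<noteq> 0" "\<And>y. y \<in> points V \<Longrightarrow> p2 y \<noteq> 0 \<Longrightarrow> p (f y) = p1 y / p2 y"
    using regular_functionE[OF poly[OF pq(1)] x] by (metis comp_apply)
  obtain q1 q2 where q: "q1 \<in> polynomial_functions (coords V)" "q2 \<in> polynomial_functions (coords V)"
    "q2 x \<noteq> 0" "\<And>y. y \<in> points V \<Longrightarrow> q2 y \<noteq> 0 \<Longrightarrow> q (f y) = q1 y / q2 y"
    using regular_functionE[OF poly[OF pq(2)] x] by (metis comp_apply)
  have "q1 x \<noteq> 0" using pq(3) q(3) q(4)[OF x] by auto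
  moreover have "(g \<circ> f) y = (p1 y * (q2 y * q2 y)) / (p2 y * (q1 y * q2 y))"
    if y: "y \<in> points V" and nz: "p2 y * (q1 y * q2 y) \<noteq> 0" for y
    using p(4)[OF y] q(4)[OF y] pq(4)[OF fW[OF y]] nz by auto
  \<comment> \<open>The factor \<open>q2\<close> cancels, but it confines the claim to points where \<open>q1 / q2\<close> represents \<open>q \<circ> f\<close>.\<close>
  ultimately show "\<exists>a \<in> polynomial_functions (coords V). \<exists>b \<in> polynomial_functions (coords V).
      b x \<noteq> 0 \<and> (\<forall>y \<in> points V. b y \<noteq> 0 \<longrightarrow> (g \<circ> f) y = a y / b y)"
    using p q
    by (intro bexI[of _ "\<lambda>y. p1 y * (q2 y * q2 y)"] bexI[of _ "\<lambda>y. p2 y * (q1 y * q2 y)"]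
        polynomial_functions.mult) auto
qed

section \<open>Regular families of lists\<close>

definition regular_list ::
  "('p, 'x) variety_scheme \<Rightarrow> nat \<Rightarrow> ('p \<Rightarrow> complex list) \<Rightarrow> bool" where
  "regular_list V m f \<longleftrightarrow>
    (\<forall>v \<in> points V. length (f v) = m) \<and> (\<forall>k<m. regular_function V (\<lambda>v. f v ! k))"

lemma regular_listI:
  assumes "\<And>v. v \<in> points V \<Longrightarrow> length (f v) = m"
    and "\<And>k. k < m \<Longrightarrow> regular_function V (\<lambda>v. f v ! k)"
  shows "regular_list V m f"
  using assms by (simp add: regular_list_def)

lemma regular_list_nth: "regular_list V m f \<Longrightarrow> k < m \<Longrightarrow> regular_function V (\<lambda>v. f v ! k)"
  by (simp add: regular_list_def)

lemma regular_list_length: "regular_list V m f \<Longrightarrow> v \<in> points V \<Longrightarrow> length (f v) = m"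
  by (simp add: regular_list_def)

lemma regular_list_Nil: "regular_list V 0 (\<lambda>_. [])"
  by (simp add: regular_list_def)

lemma regular_list_Cons:
  assumes "regular_function V x" "regular_list V m f"
  shows "regular_list V (Suc m) (\<lambda>v. x v # f v)"
proof (rule regular_listI)
  fix k assume "k < Suc m"
  then show "regular_function V (\<lambda>v. (x v # f v) ! k)"
    using assms by (cases k) (auto simp: regular_list_def)
qed (use assms in \<open>auto simp: regular_list_def\<close>)

lemma regular_list_append:
  assumes "regular_list V a f" "regular_list V b g"
  shows "regular_list V (a + b) (\<lambda>v. f v @ g v)"
proof (rule regular_listI)
  fix k assume k: "k < a + b"
  have "regular_function V (\<lambda>v. (f v @ g v) ! k) \<longleftrightarrow>
      regular_function V (\<lambda>v. if k < a then f v ! k else g v ! (k - a))"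
    by (rule regular_function_cong) (use assms in \<open>auto simp: regular_list_def nth_append\<close>)
  then show "regular_function V (\<lambda>v. (f v @ g v) ! k)"
    using assms k by (cases "k < a") (auto simp: regular_list_def)
qed (use assms in \<open>auto simp: regular_list_def\<close>)

lemma regular_list_take:
  assumes "regular_list V m f" "k \<le> m"
  shows "regular_list V k (\<lambda>v. take k (f v))"
  using assms by (auto simp: regular_list_def)

lemma regular_list_drop:
  assumes "regular_list V m f"
  shows "regular_list V (m - k) (\<lambda>v. drop k (f v))"
proof (rule regular_listI)
  fix q assume q: "q < m - k"
  have "regular_function V (\<lambda>v. drop k (f v) ! q) \<longleftrightarrow> regular_function V (\<lambda>v. f v ! (k + q))"
    by (rule regular_function_cong) (use assms q in \<open>auto simp: regular_list_def\<close>)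
  then show "regular_function V (\<lambda>v. drop k (f v) ! q)"
    using assms q by (auto simp: regular_list_def)
qed (use assms in \<open>auto simp: regular_list_def\<close>)

section \<open>Isomorphisms and products of varieties\<close>

lemma regular_mapI:
  assumes "\<And>x. x \<in> points V \<Longrightarrow> f x \<in> points W"
    and "\<And>c. c \<in> coords W \<Longrightarrow> regular_function V (\<lambda>x. c (f x))"
  shows "regular_map V W f"
  using assms by (auto simp: regular_map_def o_def)

lemma regular_list_comp:
  assumes "regular_map V W f" "regular_list W m g"
  shows "regular_list V m (\<lambda>v. g (f v))"
proof (rule regular_listI)
  fix v assume "v \<in> points V"
  then show "length (g (f v)) = m" using assms by (auto simp: regular_map_def regular_list_def)
next
  fix k assume "k < m"
  then show "regular_function V (\<lambda>v. g (f v) ! k)"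
    using regular_function_comp[OF assms(1) regular_list_nth[OF assms(2)], of k] by (simp add: o_def)
qed

lemma regular_map_comp:
  assumes "regular_map V W f" "regular_map W X g"
  shows "regular_map V X (g \<circ> f)"
  using assms regular_function_comp[OF assms(1)]
  by (fastforce simp: regular_map_def simp flip: comp_assoc)

lemma variety_isoI:
  assumes "regular_map V W f" "regular_map W V g"
    and "\<And>x. x \<in> points V \<Longrightarrow> g (f x) = x" "\<And>y. y \<in> points W \<Longrightarrow> f (g y) = y"
  shows "variety_iso V W f"
  using assms by (auto simp: variety_iso_def)

lemma variety_iso_comp:
  assumes "variety_iso V W f" "variety_iso W X g"
  shows "variety_iso V X (g \<circ> f)"
proof -
  obtain f' where f: "regular_map V W f" "regular_map W V f'"
    "\<forall>x \<in> points V. f' (f x) = x" "\<forall>y \<in> points W. f (f' y) = y"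
    using assms(1) by (auto simp: variety_iso_def)
  obtain g' where g: "regular_map W X g" "regular_map X W g'"
    "\<forall>x \<in> points W. g' (g x) = x" "\<forall>y \<in> points X. g (g' y) = y"
    using assms(2) by (auto simp: variety_iso_def)
  have "f x \<in> points W" if "x \<in> points V" for x using f(1) that by (auto simp: regular_map_def)
  moreover have "g' y \<in> points W" if "y \<in> points X" for y
    using g(2) that by (auto simp: regular_map_def)
  ultimately show ?thesis
    using f g by (intro variety_isoI[where g = "f' \<circ> g'"]) (auto intro: regular_map_comp)
qed

definition prod_variety ::
  "('p, 'x) variety_scheme \<Rightarrow> ('q, 'y) variety_scheme \<Rightarrow> ('p \<times> 'q) variety" where
  "prod_variety V W =
    \<lparr> points = points V \<times> points W, coords = {c \<circ> fst | c. c \<in> coords V} \<union> {c \<circ> snd | c. c \<in> coords W} \<rparr>"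

lemma points_prod_variety [simp]: "points (prod_variety V W) = points V \<times> points W"
  by (simp add: prod_variety_def)

lemma regular_map_fst: "regular_map (prod_variety V W) V fst"
  by (auto simp: regular_map_def prod_variety_def intro!: regular_function_coord)

lemma regular_map_snd: "regular_map (prod_variety V W) W snd"
  by (auto simp: regular_map_def prod_variety_def intro!: regular_function_coord)

lemma regular_map_Pair:
  assumes "regular_map V W f" "regular_map V X g"
  shows "regular_map V (prod_variety W X) (\<lambda>x. (f x, g x))"
  using assms by (fastforce simp: regular_map_def prod_variety_def o_def)

lemma variety_iso_prod_left:
  assumes "variety_iso V W f"
  shows "variety_iso (prod_variety V X) (prod_variety W X) (\<lambda>p. (f (fst p), snd p))"
proof -
  obtain f' where f: "regular_map V W f" "regular_map W V f'"
    "\<forall>x \<in> points V. f' (f x) = x" "\<forall>y \<in> points W. f (f' y) = y"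
    using assms(1) by (auto simp: variety_iso_def)
  have "regular_map (prod_variety V X) (prod_variety W X) (\<lambda>p. ((f \<circ> fst) p, snd p))"
    by (intro regular_map_Pair regular_map_comp[OF regular_map_fst] regular_map_snd f)
  moreover have "regular_map (prod_variety W X) (prod_variety V X) (\<lambda>p. ((f' \<circ> fst) p, snd p))"
    by (intro regular_map_Pair regular_map_comp[OF regular_map_fst] regular_map_snd f)
  ultimately show ?thesis
    using f(3,4)
    by (intro variety_isoI[where g = "\<lambda>p. (f' (fst p), snd p)"]) (auto simp: o_def)
qed

lemma points_affine_torus:
  "points (affine_torus a b) = {(s, t). length s = a \<and> length t = b \<and> 0 \<notin> set t}"
  by (auto simp: affine_torus_def in_set_conv_nth)

lemma coords_affine_torus:
  "coords (affine_torus a b) = {\<lambda>p. fst p ! k | k. k < a} \<union> {\<lambda>p. snd p ! k | k. k < b}"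
  by (simp add: affine_torus_def case_prod_beta')

lemma regular_map_affine_torus:
  assumes "\<And>v. v \<in> points V \<Longrightarrow> 0 \<notin> set (t v)" "regular_list V a s" "regular_list V b t"
  shows "regular_map V (affine_torus a b) (\<lambda>v. (s v, t v))"
  using assms by (intro regular_mapI) (auto simp: points_affine_torus coords_affine_torus regular_list_def)

lemma regular_list_affine_torus:
  assumes "regular_map V (affine_torus a b) f"
  shows "regular_list V a (\<lambda>v. fst (f v))" "regular_list V b (\<lambda>v. snd (f v))"
  using assms
  by (auto simp: regular_map_def points_affine_torus coords_affine_torus o_def case_prod_beta'
      intro!: regular_listI)

lemma affine_torus_prod:
  "\<exists>f. variety_iso (prod_variety X (affine_torus (a + c) (b + d)))
     (prod_variety (prod_variety X (affine_torus a b)) (affine_torus c d)) f"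
proof -
  let ?S = "prod_variety X (affine_torus (a + c) (b + d))"
    and ?T = "prod_variety (prod_variety X (affine_torus a b)) (affine_torus c d)"
  define cut :: "'a \<times> complex list \<times> complex list \<Rightarrow>
      ('a \<times> complex list \<times> complex list) \<times> complex list \<times> complex list"
    where "cut = (\<lambda>p. ((fst p, take a (fst (snd p)), take b (snd (snd p))),
      drop a (fst (snd p)), drop b (snd (snd p))))"
  define merge :: "('a \<times> complex list \<times> complex list) \<times> complex list \<times> complex list \<Rightarrow>
      'a \<times> complex list \<times> complex list"
    where "merge = (\<lambda>p. (fst (fst p), fst (snd (fst p)) @ fst (snd p), snd (snd (fst p)) @ snd (snd p)))"
  note S = regular_list_affine_torus[OF regular_map_snd[of X "affine_torus (a + c) (b + d)"]]
  note T = regular_map_fst[of "prod_variety X (affine_torus a b)" "affine_torus c d"]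
    regular_list_affine_torus[OF regular_map_snd[of "prod_variety X (affine_torus a b)" "affine_torus c d"]]
  note T' = regular_map_comp[OF T(1) regular_map_fst]
    regular_list_affine_torus[OF regular_map_comp[OF T(1) regular_map_snd]]
  have "regular_map ?S ?T cut"
    unfolding cut_def
    using S regular_list_take[OF S(1), of a] regular_list_take[OF S(2), of b]
      regular_list_drop[OF S(1), of a] regular_list_drop[OF S(2), of b]
    by (intro regular_map_Pair regular_map_fst regular_map_affine_torus)
      (auto simp: points_affine_torus dest: in_set_takeD in_set_dropD)
  moreover have "regular_map ?T ?S merge"
    unfolding merge_def
    using T' regular_list_append[OF T'(2) T(2)] regular_list_append[OF T'(3) T(3)]
    by (intro regular_map_Pair regular_map_affine_torus) (auto simp: points_affine_torus o_def)
  ultimately have "variety_iso ?S ?T cut"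
    by (rule variety_isoI) (auto simp: cut_def merge_def points_affine_torus)
  then show ?thesis by blast
qed

section \<open>Braid matrices\<close>

definition braid_gen_inv :: "nat \<Rightarrow> nat \<Rightarrow> complex \<Rightarrow> complex mat" where
  "braid_gen_inv n i z = mat n n (\<lambda>(r, c).
     if r = i - 1 \<and> c = i - 1 then - z
     else if r = i - 1 \<and> c = i then 1
     else if r = i \<and> c = i - 1 then 1
     else if r = i \<and> c = i then 0
     else if r = c then 1 else 0)"

lemma braid_gen_carrier [simp]: "braid_gen n i z \<in> carrier_mat n n"
  by (simp add: braid_gen_def)

lemma braid_gen_inv_carrier [simp]: "braid_gen_inv n i z \<in> carrier_mat n n"
  by (simp add: braid_gen_inv_def)

lemma dim_braid_gen [simp]:
  "dim_row (braid_gen n i z) = n" "dim_col (braid_gen n i z) = n"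
  "dim_row (braid_gen_inv n i z) = n" "dim_col (braid_gen_inv n i z) = n"
  by (simp_all add: braid_gen_def braid_gen_inv_def)

lemma braid_gen_index:
  assumes "r < n" "c < n"
  shows "braid_gen n (Suc j) z $$ (r, c) =
    (if r = j then if c = Suc j then 1 else 0
     else if r = Suc j then if c = j then 1 else if c = Suc j then z else 0
     else if r = c then 1 else 0)"
  using assms by (simp add: braid_gen_def)

lemma braid_gen_inv_index:
  assumes "r < n" "c < n"
  shows "braid_gen_inv n (Suc j) z $$ (r, c) =
    (if r = j then if c = j then - z else if c = Suc j then 1 else 0
     else if r = Suc j then if c = j then 1 else 0
     else if r = c then 1 else 0)"
  using assms by (simp add: braid_gen_inv_def)

lemma mult_carrier_square [simp]:
  "A \<in> carrier_mat n n \<Longrightarrow> B \<in> carrier_mat n n \<Longrightarrow> A * B \<in> carrier_mat n n"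
  by (rule mult_carrier_mat)

lemma sum_two_deltas:
  fixes f :: "nat \<Rightarrow> complex"
  assumes "a < n" "b < n" "a \<noteq> b" "\<And>k. k \<noteq> a \<Longrightarrow> k \<noteq> b \<Longrightarrow> f k = 0"
  shows "(\<Sum>k = 0..<n. f k) = f a + f b"
proof -
  have "(\<Sum>k = 0..<n. f k) = (\<Sum>k\<in>{a, b}. f k)"
    by (rule sum.mono_neutral_right) (use assms in auto)
  then show ?thesis using assms(3) by simp
qed

lemma sum_single_delta:
  fixes f :: "nat \<Rightarrow> complex"
  assumes "a < n" "\<And>k. k \<noteq> a \<Longrightarrow> f k = 0"
  shows "(\<Sum>k = 0..<n. f k) = f a"
proof -
  have "(\<Sum>k = 0..<n. f k) = (\<Sum>k\<in>{a}. f k)"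
    by (rule sum.mono_neutral_right) (use assms in auto)
  then show ?thesis by simp
qed

text \<open>
  Products with braid matrices are operations on two adjacent rows or columns. Computing them
  entrywise in this form avoids all further sums in the calculations below.
\<close>

lemma mult_braid_gen_index:
  assumes "Suc j < n" "A \<in> carrier_mat n n" "r < n" "c < n"
  shows "(A * braid_gen n (Suc j) z) $$ (r, c) =
    (if c = j then A $$ (r, Suc j) else if c = Suc j then A $$ (r, j) + z * A $$ (r, Suc j)
     else A $$ (r, c))"
proof -
  let ?f = "\<lambda>k. A $$ (r, k) * braid_gen n (Suc j) z $$ (k, c)"
  have eq: "(A * braid_gen n (Suc j) z) $$ (r, c) = (\<Sum>k = 0..<n. if k < n then ?f k else 0)"
    using assms by (auto simp: scalar_prod_def intro!: sum.cong)
  consider "c = j" | "c = Suc j" | "c \<noteq> j" "c \<noteq> Suc j" by blast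
  then show ?thesis
  proof cases
    case 1
    then show ?thesis unfolding eq using assms
      by (subst sum_single_delta[of "Suc j"]) (auto simp: braid_gen_index)
  next
    case 2
    then show ?thesis unfolding eq using assms
      by (subst sum_two_deltas[of j _ "Suc j"]) (auto simp: braid_gen_index)
  next
    case 3
    then show ?thesis unfolding eq using assms
      by (subst sum_single_delta[of "c"]) (auto simp: braid_gen_index)
  qed
qed

lemma braid_gen_mult_index:
  assumes "Suc j < n" "A \<in> carrier_mat n n" "r < n" "c < n"
  shows "(braid_gen n (Suc j) z * A) $$ (r, c) =
    (if r = j then A $$ (Suc j, c) else if r = Suc j then A $$ (j, c) + z * A $$ (Suc j, c)
     else A $$ (r, c))"
proof -
  let ?f = "\<lambda>k. braid_gen n (Suc j) z $$ (r, k) * A $$ (k, c)"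
  have eq: "(braid_gen n (Suc j) z * A) $$ (r, c) = (\<Sum>k = 0..<n. if k < n then ?f k else 0)"
    using assms by (auto simp: scalar_prod_def intro!: sum.cong)
  consider "r = j" | "r = Suc j" | "r \<noteq> j" "r \<noteq> Suc j" by blast
  then show ?thesis
  proof cases
    case 1
    then show ?thesis unfolding eq using assms
      by (subst sum_single_delta[of "Suc j"]) (auto simp: braid_gen_index)
  next
    case 2
    then show ?thesis unfolding eq using assms
      by (subst sum_two_deltas[of j _ "Suc j"]) (auto simp: braid_gen_index)
  next
    case 3
    then show ?thesis unfolding eq using assms
      by (subst sum_single_delta[of "r"]) (auto simp: braid_gen_index)
  qed
qed

lemma mult_braid_gen_inv_index:
  assumes "Suc j < n" "A \<in> carrier_mat n n" "r < n" "c < n"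
  shows "(A * braid_gen_inv n (Suc j) z) $$ (r, c) =
    (if c = j then A $$ (r, Suc j) - z * A $$ (r, j) else if c = Suc j then A $$ (r, j)
     else A $$ (r, c))"
proof -
  let ?f = "\<lambda>k. A $$ (r, k) * braid_gen_inv n (Suc j) z $$ (k, c)"
  have eq: "(A * braid_gen_inv n (Suc j) z) $$ (r, c) = (\<Sum>k = 0..<n. if k < n then ?f k else 0)"
    using assms by (auto simp: scalar_prod_def intro!: sum.cong)
  consider "c = j" | "c = Suc j" | "c \<noteq> j" "c \<noteq> Suc j" by blast
  then show ?thesis
  proof cases
    case 1
    then show ?thesis unfolding eq using assms
      by (subst sum_two_deltas[of j _ "Suc j"]) (auto simp: braid_gen_inv_index)
  next
    case 2
    then show ?thesis unfolding eq using assms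
      by (subst sum_single_delta[of "j"]) (auto simp: braid_gen_inv_index)
  next
    case 3
    then show ?thesis unfolding eq using assms
      by (subst sum_single_delta[of "c"]) (auto simp: braid_gen_inv_index)
  qed
qed

lemma braid_gen_inverse:
  assumes "1 \<le> i" "i < n"
  shows "braid_gen n i z * braid_gen_inv n i z = 1\<^sub>m n"
    and "braid_gen_inv n i z * braid_gen n i z = 1\<^sub>m n"
proof -
  obtain j where j: "i = Suc j" "Suc j < n" using assms by (cases i) auto
  have "(braid_gen n (Suc j) z * braid_gen_inv n (Suc j) z) $$ (r, c) = 1\<^sub>m n $$ (r, c)"
    if "r < n" "c < n" for r c
    unfolding mult_braid_gen_inv_index[OF j(2) braid_gen_carrier that]
    using that j(2) by (auto simp: braid_gen_index)
  then show "braid_gen n i z * braid_gen_inv n i z = 1\<^sub>m n"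
    unfolding j(1) by (intro eq_matI) simp_all
  then show "braid_gen_inv n i z * braid_gen n i z = 1\<^sub>m n"
    by (rule mat_mult_left_right_inverse[OF braid_gen_carrier braid_gen_inv_carrier])
qed

lemma mult_braid_gen_eq_iff:
  assumes "1 \<le> i" "i < n" "A \<in> carrier_mat n n" "U \<in> carrier_mat n n"
  shows "A = U * braid_gen n i z \<longleftrightarrow> U = A * braid_gen_inv n i z"
proof
  assume "A = U * braid_gen n i z"
  then have "A * braid_gen_inv n i z = U * (braid_gen n i z * braid_gen_inv n i z)"
    using assms by (simp add: assoc_mult_mat[of _ n n _ n _ n])
  then show "U = A * braid_gen_inv n i z" using assms by (simp add: braid_gen_inverse)
next
  assume "U = A * braid_gen_inv n i z"
  then have "U * braid_gen n i z = A * (braid_gen_inv n i z * braid_gen n i z)"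
    using assms by (simp add: assoc_mult_mat[of _ n n _ n _ n])
  then show "A = U * braid_gen n i z" using assms by (simp add: braid_gen_inverse)
qed

text \<open>
  Nonvanishing of the diagonal is the form of invertibility that is read off directly from the
  matrices below, and it provides the denominators of the regular functions.
\<close>

lemma borel_subgroup_iff:
  "U \<in> borel_subgroup n \<longleftrightarrow>
    U \<in> carrier_mat n n \<and> upper_triangular U \<and> (\<forall>r<n. U $$ (r, r) \<noteq> 0)"
proof -
  have "invertible_mat U \<longleftrightarrow> (\<forall>r<n. U $$ (r, r) \<noteq> 0)"
    if U: "U \<in> carrier_mat n n" "upper_triangular U"
  proof -
    have "invertible_mat U \<longleftrightarrow> det U \<noteq> 0"
    proof
      assume "invertible_mat U"
      then obtain V where V: "U * V = 1\<^sub>m n" "V * U = 1\<^sub>m (dim_row V)"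
        using U by (auto simp: invertible_mat_def inverts_mat_def)
      have "V \<in> carrier_mat n n"
        using V U by (metis carrier_matD(2) carrier_matI index_mult_mat(3) index_one_mat(3))
      then have "det U * det V = 1" using V(1) U(1) det_mult by (metis det_one)
      then show "det U \<noteq> 0" by auto
    next
      assume "det U \<noteq> 0"
      then obtain V where "V \<in> carrier_mat n n" "V * U = 1\<^sub>m n" "U * V = 1\<^sub>m n"
        using det_non_zero_imp_unit[OF U(1)] by (auto simp: Units_def ring_mat_def)
      then show "invertible_mat U" using U(1)
        by (auto simp: invertible_mat_def inverts_mat_def square_mat.simps)
    qed
    then show ?thesis
      using U by (auto simp: upper_triangular_imp_det_eq_0_iff[OF U] diag_mat_def image_iff)
  qed
  then show ?thesis by (auto simp: borel_subgroup_def)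
qed

lemma borel_subgroup_carrier: "U \<in> borel_subgroup n \<Longrightarrow> U \<in> carrier_mat n n"
  by (simp add: borel_subgroup_iff)

lemma upper_triangular_mult:
  fixes A B :: "complex mat"
  assumes "A \<in> carrier_mat n n" "B \<in> carrier_mat n n" "upper_triangular A" "upper_triangular B"
  shows "upper_triangular (A * B)"
proof (rule upper_triangularI)
  fix r c assume rc: "c < r" "r < dim_row (A * B)"
  have "A $$ (r, k) * B $$ (k, c) = 0" if "k < n" for k
  proof (cases "k < r")
    case True
    then show ?thesis using upper_triangularD[OF assms(3), of k r] assms(1) rc by simp
  next
    case False
    then show ?thesis using upper_triangularD[OF assms(4), of c k] assms(2) rc that by simp
  qed
  then show "(A * B) $$ (r, c) = 0"
    using assms rc by (auto simp: scalar_prod_def intro!: sum.neutral)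
qed

lemma braid_mat_Nil [simp]: "braid_mat n [] z = 1\<^sub>m n"
  by (simp add: braid_mat_def)

lemma braid_mat_Cons [simp]: "braid_mat n (i # \<beta>) (x # z) = braid_gen n i x * braid_mat n \<beta> z"
  by (simp add: braid_mat_def)

lemma braid_mat_carrier [simp]: "length z = length \<beta> \<Longrightarrow> braid_mat n \<beta> z \<in> carrier_mat n n"
  by (induction z \<beta> rule: list_induct2) auto

lemma braid_mat_append:
  assumes "length x = length u" "length y = length v"
  shows "braid_mat n (u @ v) (x @ y) = braid_mat n u x * braid_mat n v y"
  using assms
  by (induction x u rule: list_induct2)
    (auto simp: assoc_mult_mat[of _ n n _ n _ n] left_mult_one_mat[of _ n n])

section \<open>Moving a triangular matrix across letters\<close>

definition slide_mat :: "nat \<Rightarrow> nat \<Rightarrow> complex \<Rightarrow> complex mat \<Rightarrow> complex \<Rightarrow> complex mat" where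
  "slide_mat n i x U x' = braid_gen n i x * U * braid_gen_inv n i x'"

lemma slide_mat_iff:
  assumes "1 \<le> i" "i < n" "U \<in> carrier_mat n n" "V \<in> carrier_mat n n"
  shows "braid_gen n i x * U = V * braid_gen n i x' \<longleftrightarrow> V = slide_mat n i x U x'"
  unfolding slide_mat_def using assms by (intro mult_braid_gen_eq_iff) auto

lemma slide_mat_index:
  assumes "Suc j < n" "U \<in> carrier_mat n n" "r < n" "c < n"
  shows "slide_mat n (Suc j) x U x' $$ (r, c) =
    (let R = (\<lambda>c. if r = j then U $$ (Suc j, c) else if r = Suc j then U $$ (j, c) + x * U $$ (Suc j, c)
                 else U $$ (r, c))
     in if c = j then R (Suc j) - x' * R j else if c = Suc j then R j else R c)"
proof -
  have BU: "braid_gen n (Suc j) x * U \<in> carrier_mat n n" using assms by simp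
  show ?thesis
    unfolding slide_mat_def mult_braid_gen_inv_index[OF assms(1) BU assms(3,4)]
    using assms by (simp add: braid_gen_mult_index Let_def del: index_mult_mat)
qed

text \<open>
  Only the entry below the diagonal in the block of the letter can obstruct triangularity, and it
  is affine in both variables with the nonzero diagonal entries of \<open>U\<close> as coefficients.
\<close>

lemma slide_mat_borel_iff:
  assumes i: "1 \<le> i" "i < n" and U: "U \<in> borel_subgroup n"
  shows "slide_mat n i x U x' \<in> borel_subgroup n \<longleftrightarrow>
    U $$ (i - 1, i - 1) * x' = U $$ (i - 1, i) + x * U $$ (i, i)"
proof -
  have Uc: "U \<in> carrier_mat n n" and Ud: "\<And>r. r < n \<Longrightarrow> U $$ (r, r) \<noteq> 0"
    and U0: "\<And>r c. c < r \<Longrightarrow> r < n \<Longrightarrow> U $$ (r, c) = 0"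
    using U by (auto simp: borel_subgroup_iff)
  have Sc: "slide_mat n i x U x' \<in> carrier_mat n n" using Uc by (auto simp: slide_mat_def)
  obtain j where j: "i = Suc j" "Suc j < n" using i by (cases i) auto
  have S: "slide_mat n i x U x' $$ (r, c) =
    (if r = j then if c = j then U $$ (i, i) - x' * U $$ (i, j) else if c = i then U $$ (i, j) else U $$ (i, c)
     else if r = i then
       if c = j then U $$ (j, i) + x * U $$ (i, i) - x' * (U $$ (j, j) + x * U $$ (i, j))
       else if c = i then U $$ (j, j) + x * U $$ (i, j) else U $$ (j, c) + x * U $$ (i, c)
     else if c = j then U $$ (r, i) - x' * U $$ (r, j) else if c = i then U $$ (r, j) else U $$ (r, c))"
    if "r < n" "c < n" for r c
    using slide_mat_index[OF j(2) Uc that] j(1) by (simp add: Let_def)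
  have zero: "U $$ (i, j) = 0" using U0 j i by simp
  have "slide_mat n i x U x' $$ (r, r) \<noteq> 0" if "r < n" for r
    using that i j by (subst S) (auto simp: U0 Ud)
  moreover have "slide_mat n i x U x' $$ (r, c) = 0" if lt: "c < r" "r < n" "r \<noteq> i \<or> c \<noteq> j" for r c
  proof -
    consider "r < j" | "r = j" | "r = i" "c < j" | "i < r" using lt j by linarith
    then show ?thesis
    proof cases
      case 1
      then show ?thesis using lt i j by (subst S) (auto simp: U0)
    next
      case 2
      then show ?thesis using lt i j by (subst S) (auto simp: U0)
    next
      case 3
      then show ?thesis using lt i j by (subst S) (auto simp: U0)
    next
      case 4
      then show ?thesis using lt i j by (subst S) (auto simp: U0)
    qed
  qed
  moreover have "slide_mat n i x U x' $$ (i, j) = U $$ (j, i) + x * U $$ (i, i) - x' * U $$ (j, j)"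
    using i j zero by (subst S) auto
  ultimately have "slide_mat n i x U x' \<in> borel_subgroup n \<longleftrightarrow>
      U $$ (j, i) + x * U $$ (i, i) - x' * U $$ (j, j) = 0"
    using Sc i j unfolding borel_subgroup_iff upper_triangular_def by (metis carrier_matD(1) lessI)
  then show ?thesis using j by (auto simp: algebra_simps)
qed

text \<open>
  The chain of equations between the matrices \<open>U\<^sub>0, \<dots>, U\<^sub>p\<close> to the left of a vertex, by recursion on the
  letters in order to be amenable to induction: \<open>U\<^sub>p\<close>, the last matrix, comes from the vertex, and
  \<open>U\<^sub>0\<close> comes out at the left end of the word.
\<close>

fun slides :: "nat \<Rightarrow> nat list \<Rightarrow> complex list \<Rightarrow> complex list \<Rightarrow> complex mat list \<Rightarrow> bool" where
  "slides n [] z z' Us \<longleftrightarrow> z = [] \<and> z' = [] \<and> (\<exists>U \<in> borel_subgroup n. Us = [U])"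
| "slides n (i # l) z z' Us \<longleftrightarrow>
    (\<exists>x zs x' zs' U Vs. z = x # zs \<and> z' = x' # zs' \<and> Us = U # Vs \<and> slides n l zs zs' Vs \<and>
       U \<in> borel_subgroup n \<and> braid_gen n i x * hd Vs = U * braid_gen n i x')"

lemma slides_iff:
  "slides n l z z' Us \<longleftrightarrow>
    length z = length l \<and> length z' = length l \<and> length Us = Suc (length l) \<and>
    set Us \<subseteq> borel_subgroup n \<and>
    (\<forall>q \<in> {1..length l}. braid_gen n (l ! (q - 1)) (z ! (q - 1)) * Us ! q =
       Us ! (q - 1) * braid_gen n (l ! (q - 1)) (z' ! (q - 1)))"
proof (induction l arbitrary: z z' Us)
  case Nil
  then show ?case by (auto simp: length_Suc_conv)
next
  case (Cons i l)
  have all: "(\<forall>q\<in>{1..Suc m}. P q) \<longleftrightarrow> P 1 \<and> (\<forall>q\<in>{1..m}. P (Suc q))" for m :: nat and P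
  proof -
    have "{1..Suc m} = insert 1 (Suc ` {1..m})"
      by auto
    then show ?thesis by (simp only: ball_simps)
  qed
  have ne: "Vs ! 0 = hd Vs" if "length Vs = Suc k" for Vs :: "complex mat list" and k
    using that by (cases Vs) auto
  have step: "(\<forall>q\<in>{1..length (i # l)}. braid_gen n ((i # l) ! (q - 1)) ((x # zs) ! (q - 1)) * (U # Vs) ! q =
       (U # Vs) ! (q - 1) * braid_gen n ((i # l) ! (q - 1)) ((x' # zs') ! (q - 1))) \<longleftrightarrow>
     braid_gen n i x * Vs ! 0 = U * braid_gen n i x' \<and>
     (\<forall>q\<in>{1..length l}. braid_gen n (l ! (q - 1)) (zs ! (q - 1)) * Vs ! q =
       Vs ! (q - 1) * braid_gen n (l ! (q - 1)) (zs' ! (q - 1)))" for x zs x' zs' U Vs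
    unfolding list.size add_Suc_right add_0_right all
    by (intro conj_cong ball_cong refl) (auto simp: nth_Cons_pos)
  show ?case
  proof (cases "length z = Suc (length l) \<and> length z' = Suc (length l) \<and> length Us = Suc (Suc (length l))")
    case True
    then obtain x zs x' zs' U Vs where "z = x # zs" "z' = x' # zs'" "Us = U # Vs"
      "length zs = length l" "length zs' = length l" "length Vs = Suc (length l)"
      by (auto simp: length_Suc_conv)
    then show ?thesis using step[of x zs U Vs x' zs'] Cons.IH[of zs zs' Vs] ne[of Vs "length l"] by auto
  next
    case False
    then show ?thesis using Cons.IH by auto
  qed
qed

lemma slides_nonempty: "slides n l z z' Us \<Longrightarrow> Us \<noteq> []"
  by (cases l) auto

lemma slides_borel:
  assumes "slides n l z z' Us"
  shows "hd Us \<in> borel_subgroup n" "last Us \<in> borel_subgroup n"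
  using assms slides_nonempty[OF assms] unfolding slides_iff by auto

lemma slides_braid_mat:
  assumes "slides n l z z' Us"
  shows "braid_mat n l z * last Us = hd Us * braid_mat n l z'"
  using assms
proof (induction l arbitrary: z z' Us)
  case Nil
  then show ?case by (auto simp: borel_subgroup_iff)
next
  case (Cons i l)
  then obtain x zs x' zs' U Vs where *: "z = x # zs" "z' = x' # zs'" "Us = U # Vs"
    "slides n l zs zs' Vs" "U \<in> borel_subgroup n" "braid_gen n i x * hd Vs = U * braid_gen n i x'"
    by auto
  note carrier = borel_subgroup_carrier[OF *(5)] slides_borel[OF *(4), THEN borel_subgroup_carrier]
  have len: "length zs = length l" "length zs' = length l" using *(4) by (auto simp: slides_iff)
  have "braid_mat n (i # l) z * last Us = braid_gen n i x * (braid_mat n l zs * last Vs)"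
    using * carrier len slides_nonempty[OF *(4)] by (simp add: assoc_mult_mat[of _ n n _ n _ n])
  also have "\<dots> = (braid_gen n i x * hd Vs) * braid_mat n l zs'"
    using Cons.IH[OF *(4)] carrier len by (simp add: assoc_mult_mat[of _ n n _ n _ n])
  also have "\<dots> = hd Us * braid_mat n (i # l) z'"
    using * carrier len by (simp add: assoc_mult_mat[of _ n n _ n _ n])
  finally show ?case .
qed

fun slide_back :: "nat \<Rightarrow> nat list \<Rightarrow> complex list \<Rightarrow> complex mat \<Rightarrow> complex list \<times> complex mat list" where
  "slide_back n [] z' V = ([], [V])"
| "slide_back n (i # l) z' V =
    (let (zs, Us) = slide_back n l (tl z') V; U = hd Us;
         x = (U $$ (i - 1, i - 1) * hd z' - U $$ (i - 1, i)) / U $$ (i, i)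
     in (x # zs, slide_mat n i x U (hd z') # Us))"

text \<open>
  By the affine equation for a single letter, whose coefficient of the old variable is a nonzero
  diagonal entry, the new variables and the rightmost matrix determine everything else.
\<close>

lemma slides_iff_slide_back:
  assumes "braid_word n l"
  shows "slides n l z z' Us \<and> last Us = V \<longleftrightarrow>
    V \<in> borel_subgroup n \<and> length z' = length l \<and> (z, Us) = slide_back n l z' V"
  using assms
proof (induction l arbitrary: z z' Us)
  case Nil
  then show ?case by auto
next
  case (Cons i l)
  then have i: "1 \<le> i" "i < n" and l: "braid_word n l" by (auto simp: braid_word_def)
  note IH = Cons.IH[OF l]
  obtain ys Ws where Y: "slide_back n l (tl z') V = (ys, Ws)" by fastforce
  define W where "W = hd Ws"
  define y where "y = (W $$ (i - 1, i - 1) * hd z' - W $$ (i - 1, i)) / W $$ (i, i)"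
  have expand: "slide_back n (i # l) z' V = (y # ys, slide_mat n i y W (hd z') # Ws)"
    using Y by (simp add: y_def W_def Let_def)
  show ?case
  proof
    assume *: "slides n (i # l) z z' Us \<and> last Us = V"
    then obtain x zs x' zs' U Vs where **: "z = x # zs" "z' = x' # zs'" "Us = U # Vs"
      "slides n l zs zs' Vs" "U \<in> borel_subgroup n" "braid_gen n i x * hd Vs = U * braid_gen n i x'"
      by auto
    have "last Vs = V" using * **(3) slides_nonempty[OF **(4)] by auto
    then have V: "V \<in> borel_subgroup n" "length zs' = length l" "zs = ys" "Vs = Ws"
      using IH[of zs zs' Vs] **(2,4) Y by auto
    have W: "W \<in> borel_subgroup n" using slides_borel[OF **(4)] V by (simp add: W_def)
    have "U = slide_mat n i x W x'"
      using **(5,6) W V slide_mat_iff[OF i] by (simp add: W_def borel_subgroup_carrier)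
    moreover from this have "x = y"
      using **(2,5) slide_mat_borel_iff[OF i W, of x x'] W i by (auto simp: y_def borel_subgroup_iff field_simps)
    ultimately show "V \<in> borel_subgroup n \<and> length z' = length (i # l) \<and> (z, Us) = slide_back n (i # l) z' V"
      unfolding expand using ** V by simp
  next
    assume *: "V \<in> borel_subgroup n \<and> length z' = length (i # l) \<and> (z, Us) = slide_back n (i # l) z' V"
    then obtain x' zs' where z': "z' = x' # zs'" "length zs' = length l" by (cases z') auto
    have **: "slides n l ys zs' Ws" "last Ws = V" using IH[of ys zs' Ws] * z' Y by auto
    have W: "W \<in> borel_subgroup n" using slides_borel[OF **(1)] by (simp add: W_def)
    have U: "slide_mat n i y W x' \<in> borel_subgroup n"
      using W i by (subst slide_mat_borel_iff) (auto simp: y_def z' borel_subgroup_iff)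
    have "braid_gen n i y * W = slide_mat n i y W x' * braid_gen n i x'"
      using slide_mat_iff[OF i] W U by (simp add: borel_subgroup_carrier)
    then show "slides n (i # l) z z' Us \<and> last Us = V"
      using * ** z' U slides_nonempty[OF **(1)] unfolding expand by (auto simp: W_def)
  qed
qed

text \<open>
  In the same equation the coefficient of the new variable is nonzero as well, so the chain can also
  be solved in the other direction.
\<close>

lemma slides_forward_unique:
  assumes "braid_word n l" "slides n l z z' Us" "slides n l z z'' Vs" "last Us = last Vs"
  shows "z' = z'' \<and> Us = Vs"
  using assms
proof (induction l arbitrary: z z' z'' Us Vs)
  case Nil
  then show ?case by auto
next
  case (Cons i l)
  then have i: "1 \<le> i" "i < n" and l: "braid_word n l" by (auto simp: braid_word_def)
  obtain x zs x' zs' U Us' where 1: "z = x # zs" "z' = x' # zs'" "Us = U # Us'"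
    "slides n l zs zs' Us'" "U \<in> borel_subgroup n" "braid_gen n i x * hd Us' = U * braid_gen n i x'"
    using Cons.prems(2) by auto
  obtain x'' zs'' V Vs' where 2: "z'' = x'' # zs''" "Vs = V # Vs'"
    "slides n l zs zs'' Vs'" "V \<in> borel_subgroup n" "braid_gen n i x * hd Vs' = V * braid_gen n i x''"
    using Cons.prems(3) 1(1) by auto
  have eq: "zs' = zs''" "Us' = Vs'"
    using Cons.IH[OF l 1(4) 2(3)] Cons.prems(4) 1(3) 2(2) slides_nonempty[OF 1(4)] slides_nonempty[OF 2(3)]
    by auto
  have W: "hd Us' \<in> borel_subgroup n" using slides_borel[OF 1(4)] by simp
  have Ueq: "U = slide_mat n i x (hd Us') x'"
    using 1(5,6) W slide_mat_iff[OF i, of "hd Us'" U] by (simp add: borel_subgroup_carrier)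
  have Veq: "V = slide_mat n i x (hd Us') x''"
    using 2(4,5) W eq slide_mat_iff[OF i, of "hd Us'" V] by (simp add: borel_subgroup_carrier)
  have "x' = x''"
  proof -
    have "hd Us' $$ (i - 1, i - 1) \<noteq> 0" using W i by (auto simp: borel_subgroup_iff)
    moreover have "hd Us' $$ (i - 1, i - 1) * x' = hd Us' $$ (i - 1, i - 1) * x''"
      using slide_mat_borel_iff[OF i W, of x x'] slide_mat_borel_iff[OF i W, of x x'']
        1(5) 2(4) Ueq Veq by simp
    ultimately show ?thesis by simp
  qed
  then show ?case using 1 2 eq Ueq Veq by simp
qed

section \<open>The half twist\<close>

lemma half_twist_0 [simp]: "half_twist 0 = []"
  by (simp add: half_twist_def)

lemma half_twist_Suc: "half_twist (Suc m) = [1..<Suc m] @ half_twist m"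
  by (cases m) (simp_all add: half_twist_def)

lemma length_half_twist: "length (half_twist n) = n choose 2"
  by (induction n) (simp_all add: half_twist_Suc numeral_2_eq_2)

lemma half_twist_letters: "i \<in> set (half_twist m) \<Longrightarrow> 1 \<le> i \<and> i < m"
  by (auto simp: half_twist_def)

text \<open>
  Multiplying from the right by the letters of the staircase word carries the first basis vector
  through the columns, and each letter adds to it a multiple of one further basis vector.
\<close>

lemma braid_mat_staircase:
  assumes "k < n" "length z = k" "r < n" "c < n"
  shows "braid_mat n [1..<Suc k] z $$ (r, c) =
    (if c < k then (if r = Suc c then 1 else 0)
     else if c = k then (if r = 0 then 1 else if r \<le> k then z ! (r - 1) else 0)
     else if r = c then 1 else 0)"
  using assms
proof (induction k arbitrary: z r c)
  case 0
  then show ?case by auto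
next
  case (Suc k)
  then obtain y x where z: "z = y @ [x]" "length y = k" by (cases z rule: rev_cases) auto
  define M where "M = braid_mat n [1..<Suc k] y"
  have M: "M $$ (r, c) = (if c < k then (if r = Suc c then 1 else 0)
     else if c = k then (if r = 0 then 1 else if r \<le> k then y ! (r - 1) else 0)
     else if r = c then 1 else 0)" if "c < n" for c
    unfolding M_def using Suc z that by (intro Suc.IH) auto
  have carrier: "M \<in> carrier_mat n n" using z by (simp add: M_def)
  have "braid_mat n [1..<Suc (Suc k)] z = M * braid_gen n (Suc k) x"
    using z braid_mat_append[of y "[1..<Suc k]" "[x]" "[Suc k]" n]
    by (simp add: M_def right_mult_one_mat[of _ n n])
  also have "\<dots> $$ (r, c) = (if c = k then M $$ (r, Suc k)
      else if c = Suc k then M $$ (r, k) + x * M $$ (r, Suc k) else M $$ (r, c))"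
    using Suc.prems carrier by (intro mult_braid_gen_index) auto
  finally have "braid_mat n [1..<Suc (Suc k)] z $$ (r, c) = (if c = k then M $$ (r, Suc k)
      else if c = Suc k then M $$ (r, k) + x * M $$ (r, Suc k) else M $$ (r, c))" .
  then show ?case
    unfolding z(1) using M[of c] M[of k] M[of "Suc k"] Suc.prems z(2)
    by (auto simp: nth_append not_less_eq not_le simp del: upt_Suc)
qed

lemma braid_mat_outside_block:
  assumes "\<And>i. i \<in> set \<beta> \<Longrightarrow> 1 \<le> i \<and> i < m" "m \<le> n" "length z = length \<beta>"
    and "r < n" "c < n" "m \<le> r \<or> m \<le> c"
  shows "braid_mat n \<beta> z $$ (r, c) = (if r = c then 1 else 0)"
  using assms(3,1,4,6)
proof (induction z \<beta> arbitrary: r rule: list_induct2)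
  case Nil
  then show ?case using assms by simp
next
  case (Cons x z i \<beta>)
  have "1 \<le> i" "i < m" using Cons.prems by auto
  then obtain j where j: "i = Suc j" "Suc j < m" by (cases i) auto
  then have "Suc j < n" using assms(2) by simp
  then have "braid_mat n (i # \<beta>) (x # z) $$ (r, c) =
      (if r = j then braid_mat n \<beta> z $$ (Suc j, c)
       else if r = Suc j then braid_mat n \<beta> z $$ (j, c) + x * braid_mat n \<beta> z $$ (Suc j, c)
       else braid_mat n \<beta> z $$ (r, c))"
    unfolding j(1) braid_mat_Cons using Cons.hyps Cons.prems assms(5)
    by (intro braid_gen_mult_index) auto
  then show ?case using Cons.IH Cons.prems j(2) assms(2) by auto
qed

text \<open>
  The last column of the half twist on \<open>m + 1\<close> strands only involves the variables of the first
  staircase, one in each row. Once they vanish, the staircase is a cyclic shift of the rows, which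
  carries the condition for \<open>m + 1\<close> strands to the one for \<open>m\<close> strands. The matrices keep their full
  size \<open>n\<close>, so that the induction compares blocks of matrices of one size.
\<close>

lemma half_twist_antitriangular_iff:
  assumes "m \<le> n" "length z = length (half_twist m)"
  shows "(\<forall>r<m. \<forall>c<m. m \<le> r + c \<longrightarrow> braid_mat n (half_twist m) z $$ (r, c) = 0) \<longleftrightarrow> set z \<subseteq> {0}"
  using assms
proof (induction m arbitrary: z)
  case 0
  then show ?case by simp
next
  case (Suc m)
  define x where "x = take m z"
  define y where "y = drop m z"
  have len: "length x = m" "length y = length (half_twist m)" and z: "z = x @ y"
    using Suc.prems by (auto simp: x_def y_def half_twist_Suc)
  let ?S = "braid_mat n [1..<Suc m] x" and ?H = "braid_mat n (half_twist m) y"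
    and ?M = "braid_mat n (half_twist (Suc m)) z"
  have carrier: "?S \<in> carrier_mat n n" "?H \<in> carrier_mat n n" using len by (auto simp del: upt_Suc)
  have entry: "?M $$ (r, c) = (\<Sum>k = 0..<n. if k < n then ?S $$ (r, k) * ?H $$ (k, c) else 0)"
    if "r < n" "c < n" for r c
  proof -
    have "?M = ?S * ?H" unfolding half_twist_Suc z using len by (intro braid_mat_append) auto
    then show ?thesis using that carrier by (auto simp: scalar_prod_def intro!: sum.cong)
  qed
  note S = braid_mat_staircase[of m n x, OF _ len(1)]
  note H = braid_mat_outside_block[OF half_twist_letters, of _ m n y, OF _ _ len(2)]
  have last: "?M $$ (r, m) = x ! (r - 1)" if "1 \<le> r" "r \<le> m" for r
  proof -
    have "?M $$ (r, m) = ?S $$ (r, m)"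
      using that Suc.prems(1) by (subst entry, simp, simp, subst sum_single_delta[of m]) (auto simp: H simp del: upt_Suc)
    then show ?thesis using S[of r m] that Suc.prems(1) by (simp del: upt_Suc)
  qed
  have shift: "?M $$ (r, c) = ?H $$ (r - 1, c)" if "set x \<subseteq> {0}" "1 \<le> r" "r \<le> m" "c < m" for r c
  proof -
    have "x ! (r - 1) = 0" using that len nth_mem[of "r - 1" x] by fastforce
    then have row: "?S $$ (r, k) = (if k = r - 1 then 1 else 0)" if "k < n" for k
      using S[of r k] \<open>1 \<le> r\<close> \<open>r \<le> m\<close> Suc.prems(1) that by (auto simp del: upt_Suc)
    have "r < n" "c < n" using that Suc.prems(1) by auto
    then have "?M $$ (r, c) = (\<Sum>k = 0..<n. if k = r - 1 then ?H $$ (k, c) else 0)"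
      unfolding entry[OF \<open>r < n\<close> \<open>c < n\<close>] using row
      by (intro sum.cong refl) (auto simp del: upt_Suc)
    then show ?thesis using that Suc.prems(1) by simp
  qed
  have x0: "(\<forall>r<Suc m. Suc m \<le> r + m \<longrightarrow> ?M $$ (r, m) = 0) \<longleftrightarrow> set x \<subseteq> {0}"
  proof
    assume *: "\<forall>r<Suc m. Suc m \<le> r + m \<longrightarrow> ?M $$ (r, m) = 0"
    have "x ! k = 0" if "k < m" for k using *[rule_format, of "Suc k"] last[of "Suc k"] that by simp
    then show "set x \<subseteq> {0}" using len by (auto simp: in_set_conv_nth)
  next
    assume *: "set x \<subseteq> {0}"
    show "\<forall>r<Suc m. Suc m \<le> r + m \<longrightarrow> ?M $$ (r, m) = 0"
    proof (intro allI impI)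
      fix r assume r: "r < Suc m" "Suc m \<le> r + m"
      then have "x ! (r - 1) = 0" using * len nth_mem[of "r - 1" x] by fastforce
      then show "?M $$ (r, m) = 0" using last[of r] r by simp
    qed
  qed
  have y0: "(\<forall>r<Suc m. \<forall>c<m. Suc m \<le> r + c \<longrightarrow> ?M $$ (r, c) = 0) \<longleftrightarrow> set y \<subseteq> {0}"
    if x: "set x \<subseteq> {0}"
  proof -
    have "(\<forall>r<Suc m. \<forall>c<m. Suc m \<le> r + c \<longrightarrow> ?M $$ (r, c) = 0) \<longleftrightarrow>
        (\<forall>r<m. \<forall>c<m. m \<le> r + c \<longrightarrow> ?H $$ (r, c) = 0)" (is "?l \<longleftrightarrow> ?r")
    proof
      assume l: ?l
      show ?r
      proof (intro allI impI)
        fix r c assume "r < m" "c < m" "m \<le> r + c"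
        then show "?H $$ (r, c) = 0" using l[rule_format, of "Suc r" c] shift[OF x, of "Suc r" c] by simp
      qed
    next
      assume r: ?r
      show ?l
      proof (intro allI impI)
        fix k c assume "k < Suc m" "c < m" "Suc m \<le> k + c"
        then show "?M $$ (k, c) = 0" using r[rule_format, of "k - 1" c] shift[OF x, of k c] by simp
      qed
    qed
    then show ?thesis using Suc.IH[of y] Suc.prems(1) len by simp
  qed
  have "(\<forall>r<Suc m. \<forall>c<Suc m. Suc m \<le> r + c \<longrightarrow> ?M $$ (r, c) = 0) \<longleftrightarrow>
      (\<forall>r<Suc m. Suc m \<le> r + m \<longrightarrow> ?M $$ (r, m) = 0) \<and>
      (\<forall>r<Suc m. \<forall>c<m. Suc m \<le> r + c \<longrightarrow> ?M $$ (r, c) = 0)"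
    by (auto simp: less_Suc_eq)
  then show ?case using x0 y0 z by auto
qed

lemma mult_perm_mat_index:
  assumes "\<pi> permutes {..<n}" "A \<in> carrier_mat n n" "r < n" "c < n"
  shows "(A * perm_mat n \<pi>) $$ (r, c) = A $$ (r, \<pi> c)"
proof -
  have c: "\<pi> c < n" using assms(1,4) permutes_in_image by fastforce
  have "(A * perm_mat n \<pi>) $$ (r, c) = (\<Sum>k = 0..<n. A $$ (r, k) * (if k = \<pi> c then 1 else 0))"
    using assms by (simp add: scalar_prod_def perm_mat_def)
  also have "\<dots> = (\<Sum>k = 0..<n. if k = \<pi> c then A $$ (r, k) else 0)"
    by (intro sum.cong) auto
  finally show ?thesis using c by simp
qed

text \<open>
  Multiplication by \<open>w\<^sub>0\<close> reverses the columns, which turns triangularity into the condition above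
  with \<open>m = n\<close>.
\<close>

lemma points_braid_variety_half_twist:
  "points (braid_variety n (half_twist n) (longest_perm n)) = {replicate (n choose 2) 0}"
proof -
  have "upper_triangular (braid_mat n (half_twist n) z * perm_mat n (longest_perm n)) \<longleftrightarrow> set z \<subseteq> {0}"
    if z: "length z = length (half_twist n)" for z
  proof -
    let ?M = "braid_mat n (half_twist n) z"
    have "upper_triangular (?M * perm_mat n (longest_perm n)) \<longleftrightarrow>
        (\<forall>r<n. \<forall>c<r. ?M $$ (r, n - 1 - c) = 0)"
    proof -
      have M: "?M \<in> carrier_mat n n" using z by simp
      have "(?M * perm_mat n (longest_perm n)) $$ (r, c) = ?M $$ (r, n - 1 - c)" if "r < n" "c < r" for r c
        using that mult_perm_mat_index[OF longest_perm_permutes M, of r c]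
        by (simp add: longest_perm_def del: index_mult_mat(1))
      moreover have "dim_row (?M * perm_mat n (longest_perm n)) = n" using M by simp
      ultimately show ?thesis by (simp add: upper_triangular_def del: index_mult_mat(1))
    qed
    also have "\<dots> \<longleftrightarrow> (\<forall>r<n. \<forall>c<n. n \<le> r + c \<longrightarrow> ?M $$ (r, c) = 0)"
    proof (intro iffI allI impI)
      fix r c assume *: "\<forall>r<n. \<forall>c<r. ?M $$ (r, n - 1 - c) = 0" and "r < n" "c < n" "n \<le> r + c"
      then show "?M $$ (r, c) = 0" using *[rule_format, of r "n - 1 - c"] by simp
    next
      fix r c assume *: "\<forall>r<n. \<forall>c<n. n \<le> r + c \<longrightarrow> ?M $$ (r, c) = 0" and "r < n" "c < r"
      then show "?M $$ (r, n - 1 - c) = 0" using *[rule_format, of r "n - 1 - c"] by simp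
    qed
    also have "\<dots> \<longleftrightarrow> set z \<subseteq> {0}" using z by (intro half_twist_antitriangular_iff) auto
    finally show ?thesis .
  qed
  then show ?thesis
    by (auto simp: braid_variety_def length_half_twist replicate_length_same replicate_eqI
        split: if_splits intro!: replicate_eqI)
qed

section \<open>Regular families of matrices\<close>

definition regular_mat ::
  "('p, 'x) variety_scheme \<Rightarrow> nat \<Rightarrow> ('p \<Rightarrow> complex mat) \<Rightarrow> bool" where
  "regular_mat V n M \<longleftrightarrow>
    (\<forall>v \<in> points V. M v \<in> carrier_mat n n) \<and>
    (\<forall>r<n. \<forall>c<n. regular_function V (\<lambda>v. M v $$ (r, c)))"

lemma regular_mat_cong:
  assumes "\<And>v. v \<in> points V \<Longrightarrow> M v = N v"
  shows "regular_mat V n M \<longleftrightarrow> regular_mat V n N"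
proof -
  have "regular_function V (\<lambda>v. M v $$ (r, c)) \<longleftrightarrow> regular_function V (\<lambda>v. N v $$ (r, c))" for r c
    by (rule regular_function_cong) (simp add: assms)
  then show ?thesis using assms by (simp add: regular_mat_def)
qed

lemma regular_mat_entry:
  "regular_mat V n M \<Longrightarrow> r < n \<Longrightarrow> c < n \<Longrightarrow> regular_function V (\<lambda>v. M v $$ (r, c))"
  by (simp add: regular_mat_def)

lemma regular_mat_one: "regular_mat V n (\<lambda>_. 1\<^sub>m n)"
  by (simp add: regular_mat_def regular_function_const)

lemma regular_mat_mult:
  assumes "regular_mat V n M" "regular_mat V n N"
  shows "regular_mat V n (\<lambda>v. M v * N v)"
proof -
  have "regular_function V (\<lambda>v. (M v * N v) $$ (r, c))" if "r < n" "c < n" for r c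
  proof -
    have "regular_function V (\<lambda>v. (M v * N v) $$ (r, c)) \<longleftrightarrow>
        regular_function V (\<lambda>v. \<Sum>k\<in>{0..<n}. M v $$ (r, k) * N v $$ (k, c))"
    proof (rule regular_function_cong)
      fix v assume "v \<in> points V"
      then have "M v \<in> carrier_mat n n" "N v \<in> carrier_mat n n" using assms by (auto simp: regular_mat_def)
      then show "(M v * N v) $$ (r, c) = (\<Sum>k\<in>{0..<n}. M v $$ (r, k) * N v $$ (k, c))"
        using that by (simp add: scalar_prod_def)
    qed
    moreover have "regular_function V (\<lambda>v. \<Sum>k\<in>{0..<n}. M v $$ (r, k) * N v $$ (k, c))"
      using assms that
      by (intro regular_function_sum regular_function_mult) (auto simp: regular_mat_def)
    ultimately show ?thesis by simp
  qed
  then show ?thesis using assms by (auto simp: regular_mat_def)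
qed

lemma regular_mat_braid_gen:
  assumes "regular_function V x"
  shows "regular_mat V n (\<lambda>v. braid_gen n i (x v))"
  using assms by (auto simp: regular_mat_def braid_gen_def intro!: regular_function_if regular_function_const)

lemma regular_mat_braid_gen_inv:
  assumes "regular_function V x"
  shows "regular_mat V n (\<lambda>v. braid_gen_inv n i (x v))"
  using assms regular_function_diff[OF regular_function_const[of V 0] assms]
  by (auto simp: regular_mat_def braid_gen_inv_def intro!: regular_function_if regular_function_const)

lemma regular_mat_braid_mat:
  assumes "regular_list V (length \<beta>) f"
  shows "regular_mat V n (\<lambda>v. braid_mat n \<beta> (f v))"
  using assms
proof (induction \<beta> arbitrary: f)
  case Nil
  then show ?case by (simp add: regular_mat_one)
next
  case (Cons i \<beta>)
  have tl: "regular_list V (length \<beta>) (\<lambda>v. drop 1 (f v))"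
    using regular_list_drop[OF Cons.prems, of 1] by simp
  have "regular_mat V n (\<lambda>v. braid_mat n (i # \<beta>) (f v)) \<longleftrightarrow>
      regular_mat V n (\<lambda>v. braid_gen n i (f v ! 0) * braid_mat n \<beta> (drop 1 (f v)))"
  proof (rule regular_mat_cong)
    fix v assume "v \<in> points V"
    then have "length (f v) = Suc (length \<beta>)" using Cons.prems by (simp add: regular_list_def)
    then show "braid_mat n (i # \<beta>) (f v) = braid_gen n i (f v ! 0) * braid_mat n \<beta> (drop 1 (f v))"
      by (cases "f v") auto
  qed
  also have "\<dots>"
    using regular_list_nth[OF Cons.prems, of 0]
    by (intro regular_mat_mult regular_mat_braid_gen Cons.IH[OF tl]) simp
  finally show ?case .
qed

text \<open>
  The only divisions are by diagonal entries of the intermediate matrices, which vanish nowhere.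
\<close>

lemma slide_back_regular:
  assumes "braid_word n l" "regular_list V (length l) z" "regular_mat V n M"
    and "\<And>v. v \<in> points V \<Longrightarrow> M v \<in> borel_subgroup n"
  shows "regular_list V (length l) (\<lambda>v. fst (slide_back n l (z v) (M v)))"
    and "q \<le> length l \<Longrightarrow> regular_mat V n (\<lambda>v. snd (slide_back n l (z v) (M v)) ! q)"
proof -
  have "regular_list V (length l) (\<lambda>v. fst (slide_back n l (z v) (M v))) \<and>
      (\<forall>q\<le>length l. regular_mat V n (\<lambda>v. snd (slide_back n l (z v) (M v)) ! q))"
    using assms(1,2)
  proof (induction l arbitrary: z)
    case Nil
    then show ?case using assms(3) by (auto simp: regular_list_Nil)
  next
    case (Cons i l)
    then have i: "1 \<le> i" "i < n" and l: "braid_word n l" by (auto simp: braid_word_def)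
    have tl: "regular_list V (length l) (\<lambda>v. drop 1 (z v))"
      using regular_list_drop[OF Cons.prems(2), of 1] by simp
    have hd: "regular_function V (\<lambda>v. z v ! 0)"
      using regular_list_nth[OF Cons.prems(2), of 0] by simp
    define Z where "Z = (\<lambda>v. slide_back n l (drop 1 (z v)) (M v))"
    define W where "W = (\<lambda>v. snd (Z v) ! 0)"
    define x where "x = (\<lambda>v. (W v $$ (i - 1, i - 1) * z v ! 0 - W v $$ (i - 1, i)) / W v $$ (i, i))"
    have IH: "regular_list V (length l) (\<lambda>v. fst (Z v))"
      "\<And>q. q \<le> length l \<Longrightarrow> regular_mat V n (\<lambda>v. snd (Z v) ! q)"
      using Cons.IH[OF l tl] by (auto simp: Z_def)
    have slides: "slides n l (fst (Z v)) (drop 1 (z v)) (snd (Z v))" if "v \<in> points V" for v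
      using slides_iff_slide_back[OF l, of "fst (Z v)" "drop 1 (z v)" "snd (Z v)" "M v"]
        assms(4)[OF that] regular_list_length[OF tl that] by (simp add: Z_def)
    have W_hd: "W v = hd (snd (Z v))" if "v \<in> points V" for v
      using slides_nonempty[OF slides[OF that]] by (simp add: W_def hd_conv_nth)
    have W: "regular_mat V n W" using IH(2)[of 0] by (simp add: W_def)
    have W_borel: "W v \<in> borel_subgroup n" if "v \<in> points V" for v
      using slides_borel[OF slides[OF that]] W_hd[OF that] by simp
    have x: "regular_function V x"
      unfolding x_def using W_borel i
      by (intro regular_function_divide regular_function_diff regular_function_mult hd
          regular_mat_entry[OF W]) (auto simp: borel_subgroup_iff)
    have S: "regular_mat V n (\<lambda>v. slide_mat n i (x v) (W v) (z v ! 0))"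
      unfolding slide_mat_def
      by (intro regular_mat_mult regular_mat_braid_gen regular_mat_braid_gen_inv W x hd)
    have eq: "slide_back n (i # l) (z v) (M v) =
        (x v # fst (Z v), slide_mat n i (x v) (W v) (z v ! 0) # snd (Z v))" if "v \<in> points V" for v
    proof -
      have "z v \<noteq> []" using regular_list_length[OF Cons.prems(2) that] by auto
      then show ?thesis
        using W_hd[OF that] by (simp add: Z_def x_def Let_def case_prod_beta drop_Suc hd_conv_nth)
    qed
    have "regular_list V (length (i # l)) (\<lambda>v. fst (slide_back n (i # l) (z v) (M v)))"
    proof (rule regular_listI)
      fix v assume "v \<in> points V"
      then show "length (fst (slide_back n (i # l) (z v) (M v))) = length (i # l)"
        using eq regular_list_length[OF IH(1)] by simp
    next
      fix k assume k: "k < length (i # l)"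
      have "regular_function V (\<lambda>v. fst (slide_back n (i # l) (z v) (M v)) ! k) \<longleftrightarrow>
          regular_function V (\<lambda>v. (x v # fst (Z v)) ! k)"
        by (rule regular_function_cong) (use eq in \<open>simp del: slide_back.simps\<close>)
      then show "regular_function V (\<lambda>v. fst (slide_back n (i # l) (z v) (M v)) ! k)"
        using regular_list_nth[OF regular_list_Cons[OF x IH(1)], of k] k by simp
    qed
    moreover have "regular_mat V n (\<lambda>v. snd (slide_back n (i # l) (z v) (M v)) ! q)"
      if "q \<le> length (i # l)" for q
    proof -
      have "regular_mat V n (\<lambda>v. snd (slide_back n (i # l) (z v) (M v)) ! q) \<longleftrightarrow>
          regular_mat V n (\<lambda>v. (slide_mat n i (x v) (W v) (z v ! 0) # snd (Z v)) ! q)"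
        by (rule regular_mat_cong) (use eq in \<open>simp del: slide_back.simps\<close>)
      then show ?thesis using S IH(2) that by (cases q) auto
    qed
    ultimately show ?case by blast
  qed
  then show "regular_list V (length l) (\<lambda>v. fst (slide_back n l (z v) (M v)))"
    and "q \<le> length l \<Longrightarrow> regular_mat V n (\<lambda>v. snd (slide_back n l (z v) (M v)) ! q)"
    by auto
qed

section \<open>The equations at a vertex\<close>

lemma Suc_letter:
  assumes "1 \<le> i" "i < n"
  obtains j where "i = Suc j" "Suc j < n"
  using assms by (cases i) auto

lemma double_letter_index:
  assumes "Suc j < n" "r < n" "s < n"
  shows "(braid_gen n (Suc j) a * braid_gen n (Suc j) b) $$ (r, s) =
    (if r = j then if s = j then 1 else if s = Suc j then b else 0
     else if r = Suc j then if s = j then a else if s = Suc j then 1 + a * b else 0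
     else if r = s then 1 else 0)"
  unfolding mult_braid_gen_index[OF assms(1) braid_gen_carrier assms(2,3)]
  using assms by (auto simp: braid_gen_index)

text \<open>
  The entry below the diagonal of the block is \<open>1 - a (c - b)\<close>. If it vanishes, then \<open>a\<close> and
  \<open>b - c = - 1 / a\<close> are the diagonal entries of the block, so invertibility is automatic and \<open>a\<close> is a
  free nonzero parameter.
\<close>

lemma trivalent_borel_iff:
  assumes "Suc j < n"
  shows "braid_gen n (Suc j) a * braid_gen n (Suc j) b * braid_gen_inv n (Suc j) c \<in> borel_subgroup n
    \<longleftrightarrow> a * (c - b) = 1"
proof -
  let ?M = "braid_gen n (Suc j) a * braid_gen n (Suc j) b * braid_gen_inv n (Suc j) c"
  have M: "?M $$ (r, s) =
    (if r = j then if s = j then b - c else if s = Suc j then 1 else 0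
     else if r = Suc j then if s = j then 1 - a * (c - b) else if s = Suc j then a else 0
     else if r = s then 1 else 0)" if "r < n" "s < n" for r s
    using mult_braid_gen_inv_index[OF assms mult_carrier_square[OF braid_gen_carrier braid_gen_carrier] that]
      that assms
    by (auto simp: double_letter_index algebra_simps simp del: index_mult_mat)
  have carrier: "?M \<in> carrier_mat n n" by simp
  show ?thesis
  proof
    assume "?M \<in> borel_subgroup n"
    then have "?M $$ (Suc j, j) = 0"
      using assms carrier unfolding borel_subgroup_iff by (intro upper_triangularD) auto
    then show "a * (c - b) = 1" using M[of "Suc j" j] assms by simp
  next
    assume eq: "a * (c - b) = 1"
    then have "a \<noteq> 0" "c \<noteq> b" by auto
    with eq show "?M \<in> borel_subgroup n"
      using carrier assms unfolding borel_subgroup_iff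
      by (auto simp: M simp del: index_mult_mat(1) intro!: upper_triangularI)
  qed
qed

text \<open>
  For \<open>a = 0\<close> the product is unipotent with \<open>b\<close> above the diagonal, so \<open>b\<close> is a free parameter.
\<close>

lemma cup_borel_iff:
  assumes "Suc j < n"
  shows "braid_gen n (Suc j) a * braid_gen n (Suc j) b \<in> borel_subgroup n \<longleftrightarrow> a = 0"
proof -
  let ?M = "braid_gen n (Suc j) a * braid_gen n (Suc j) b"
  have carrier: "?M \<in> carrier_mat n n" by simp
  show ?thesis
  proof
    assume "?M \<in> borel_subgroup n"
    then have "?M $$ (Suc j, j) = 0"
      using assms carrier unfolding borel_subgroup_iff by (intro upper_triangularD) auto
    then show "a = 0" using double_letter_index[of j n "Suc j" j a b] assms by simp
  next
    assume "a = 0"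
    then show "?M \<in> borel_subgroup n"
      using carrier assms unfolding borel_subgroup_iff
      by (auto simp: double_letter_index simp del: index_mult_mat(1) intro!: upper_triangularI)
  qed
qed

text \<open>
  Both sides of the braid relation on the strands \<open>k, k + 1, k + 2\<close> are parametrised bijectively
  by the three entries to the lower right of the antidiagonal of this block.
\<close>

definition braid_relation_mat :: "nat \<Rightarrow> nat \<Rightarrow> complex \<Rightarrow> complex \<Rightarrow> complex \<Rightarrow> complex mat" where
  "braid_relation_mat n k p q t = mat n n (\<lambda>(r, s).
     if s = k then if r = Suc (Suc k) then 1 else 0
     else if s = Suc k then if r = Suc k then 1 else if r = Suc (Suc k) then p else 0
     else if s = Suc (Suc k) then if r = k then 1 else if r = Suc k then q else if r = Suc (Suc k) then t else 0
     else if r = s then 1 else 0)"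

lemma braid_relation_mat_eq_iff:
  assumes "Suc (Suc k) < n"
  shows "braid_relation_mat n k p q t = braid_relation_mat n k p' q' t' \<longleftrightarrow> p = p' \<and> q = q' \<and> t = t'"
proof
  let ?M = "braid_relation_mat n k p q t" and ?M' = "braid_relation_mat n k p' q' t'"
  assume "?M = ?M'"
  then have "?M $$ (Suc (Suc k), Suc k) = ?M' $$ (Suc (Suc k), Suc k)"
    "?M $$ (Suc k, Suc (Suc k)) = ?M' $$ (Suc k, Suc (Suc k))"
    "?M $$ (Suc (Suc k), Suc (Suc k)) = ?M' $$ (Suc (Suc k), Suc (Suc k))" by simp_all
  then show "p = p' \<and> q = q' \<and> t = t'" using assms by (simp add: braid_relation_mat_def)
qed simp

lemma braid_mat_up_down_up:
  assumes "Suc (Suc k) < n"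
  shows "braid_gen n (Suc k) a * braid_gen n (Suc (Suc k)) b * braid_gen n (Suc k) c =
    braid_relation_mat n k c a b"
proof (rule eq_matI)
  fix r s assume "r < dim_row (braid_relation_mat n k c a b)" "s < dim_col (braid_relation_mat n k c a b)"
  then have rs: "r < n" "s < n" by (simp_all add: braid_relation_mat_def)
  have k: "Suc k < n" using assms by simp
  have B: "(braid_gen n (Suc k) a * braid_gen n (Suc (Suc k)) b) $$ (r, s) =
    (if s = Suc k then braid_gen n (Suc k) a $$ (r, Suc (Suc k))
     else if s = Suc (Suc k) then braid_gen n (Suc k) a $$ (r, Suc k) + b * braid_gen n (Suc k) a $$ (r, Suc (Suc k))
     else braid_gen n (Suc k) a $$ (r, s))" if "s < n" for s
    by (rule mult_braid_gen_index[OF assms braid_gen_carrier rs(1) that])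
  show "(braid_gen n (Suc k) a * braid_gen n (Suc (Suc k)) b * braid_gen n (Suc k) c) $$ (r, s) =
      braid_relation_mat n k c a b $$ (r, s)"
    unfolding mult_braid_gen_index[OF k mult_carrier_square[OF braid_gen_carrier braid_gen_carrier] rs]
    using rs assms by (auto simp: B braid_gen_index braid_relation_mat_def simp del: index_mult_mat)
qed (simp_all add: braid_relation_mat_def)

lemma braid_mat_down_up_down:
  assumes "Suc (Suc k) < n"
  shows "braid_gen n (Suc (Suc k)) a * braid_gen n (Suc k) b * braid_gen n (Suc (Suc k)) c =
    braid_relation_mat n k a c (b + a * c)"
proof (rule eq_matI)
  fix r s assume "r < dim_row (braid_relation_mat n k a c (b + a * c))" "s < dim_col (braid_relation_mat n k a c (b + a * c))"
  then have rs: "r < n" "s < n" by (simp_all add: braid_relation_mat_def)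
  have k: "Suc k < n" using assms by simp
  have B: "(braid_gen n (Suc (Suc k)) a * braid_gen n (Suc k) b) $$ (r, s) =
    (if s = k then braid_gen n (Suc (Suc k)) a $$ (r, Suc k)
     else if s = Suc k then braid_gen n (Suc (Suc k)) a $$ (r, k) + b * braid_gen n (Suc (Suc k)) a $$ (r, Suc k)
     else braid_gen n (Suc (Suc k)) a $$ (r, s))" if "s < n" for s
    by (rule mult_braid_gen_index[OF k braid_gen_carrier rs(1) that])
  show "(braid_gen n (Suc (Suc k)) a * braid_gen n (Suc k) b * braid_gen n (Suc (Suc k)) c) $$ (r, s) =
      braid_relation_mat n k a c (b + a * c) $$ (r, s)"
    unfolding mult_braid_gen_index[OF assms mult_carrier_square[OF braid_gen_carrier braid_gen_carrier] rs]
    using rs assms by (auto simp: B braid_gen_index braid_relation_mat_def simp del: index_mult_mat)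
qed (simp_all add: braid_relation_mat_def)

lemma distant_letters_index:
  assumes "Suc p < n" "Suc q < n" "Suc p < q \<or> Suc q < p" "r < n" "s < n"
  shows "(braid_gen n (Suc p) a * braid_gen n (Suc q) b) $$ (r, s) =
    (if s = p then if r = Suc p then 1 else 0
     else if s = Suc p then if r = p then 1 else if r = Suc p then a else 0
     else if s = q then if r = Suc q then 1 else 0
     else if s = Suc q then if r = q then 1 else if r = Suc q then b else 0
     else if r = s then 1 else 0)"
  unfolding mult_braid_gen_index[OF assms(2) braid_gen_carrier assms(4,5)]
  using assms by (auto simp: braid_gen_index)

lemma distant_letters_commute_iff:
  assumes "Suc p < n" "Suc q < n" "Suc p < q \<or> Suc q < p"
  shows "braid_gen n (Suc p) a * braid_gen n (Suc q) b = braid_gen n (Suc q) c * braid_gen n (Suc p) d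
    \<longleftrightarrow> a = d \<and> b = c"
proof
  let ?M = "braid_gen n (Suc p) a * braid_gen n (Suc q) b"
    and ?N = "braid_gen n (Suc q) c * braid_gen n (Suc p) d"
  note M = distant_letters_index[OF assms]
  have "Suc q < p \<or> Suc p < q" using assms(3) by blast
  note N = distant_letters_index[OF assms(2,1) this]
  assume "?M = ?N"
  then have "?M $$ (Suc p, Suc p) = ?N $$ (Suc p, Suc p)" "?M $$ (Suc q, Suc q) = ?N $$ (Suc q, Suc q)"
    by simp_all
  then show "a = d \<and> b = c"
    using assms M[of "Suc p" "Suc p" a b] M[of "Suc q" "Suc q" a b]
      N[of "Suc p" "Suc p" c d] N[of "Suc q" "Suc q" c d] by auto
next
  assume eq: "a = d \<and> b = c"
  note M = distant_letters_index[OF assms]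
  have "Suc q < p \<or> Suc p < q" using assms(3) by blast
  note N = distant_letters_index[OF assms(2,1) this]
  show "braid_gen n (Suc p) a * braid_gen n (Suc q) b = braid_gen n (Suc q) c * braid_gen n (Suc p) d"
  proof (rule eq_matI)
    fix r s assume "r < dim_row (braid_gen n (Suc q) c * braid_gen n (Suc p) d)"
      "s < dim_col (braid_gen n (Suc q) c * braid_gen n (Suc p) d)"
    then have rs: "r < n" "s < n" by simp_all
    show "(braid_gen n (Suc p) a * braid_gen n (Suc q) b) $$ (r, s) =
        (braid_gen n (Suc q) c * braid_gen n (Suc p) d) $$ (r, s)"
      unfolding M[OF rs] N[OF rs] using eq assms(3) by auto
  qed simp_all
qed

section \<open>Solving one step of a weave backwards\<close>

text \<open>
  The variety of free parameters at a vertex: a line at a cup, a punctured line at a trivalent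
  vertex, and a point otherwise.
\<close>

definition move_params :: "move \<Rightarrow> (complex list \<times> complex list) variety" where
  "move_params v = affine_torus (if is_Cup v then 1 else 0) (if is_Trivalent v then 1 else 0)"

text \<open>
  The parameter is one of the variables before the move, the first one at a trivalent vertex and the
  second one at a cup; so it is a regular function on the correspondence.
\<close>

fun vertex_read :: "move \<Rightarrow> complex list \<Rightarrow> complex list \<times> complex list" where
  "vertex_read (Trivalent i) x = ([], [x ! 0])"
| "vertex_read (Cup i) x = ([x ! 1], [])"
| "vertex_read _ x = ([], [])"

text \<open>
  The solution of the equation at a vertex for the variables before the move, given the variables \<open>y\<close>
  after it and the parameter \<open>e\<close>.
\<close>

fun vertex_lift :: "move \<Rightarrow> complex list \<Rightarrow> complex list \<times> complex list \<Rightarrow> complex list" where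
  "vertex_lift (Trivalent i) y e = [snd e ! 0, y ! 0 - 1 / snd e ! 0]"
| "vertex_lift (Cup i) y e = [0, fst e ! 0]"
| "vertex_lift (Six i j) y e =
    [y ! 2, (if j = i + 1 then y ! 1 + y ! 0 * y ! 2 else y ! 1 - y ! 0 * y ! 2), y ! 0]"
| "vertex_lift (Four i j) y e = [y ! 1, y ! 0]"
| "vertex_lift (Cap i) y e = []"

text \<open>
  The matrix \<open>B\<^sub>u B\<^sub>v\<^sup>-\<^sup>1\<close> that a trivalent vertex or a cup sends to the left.
\<close>

fun vertex_mat :: "nat \<Rightarrow> move \<Rightarrow> complex list \<Rightarrow> complex list \<Rightarrow> complex mat" where
  "vertex_mat n (Trivalent i) x y = braid_mat n [i, i] x * braid_gen_inv n i (y ! 0)"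
| "vertex_mat n v x y = braid_mat n (move_source v) x"

lemma points_move_params:
  "e \<in> points (move_params v) \<longleftrightarrow>
    length (fst e) = (if is_Cup v then 1 else 0) \<and> length (snd e) = (if is_Trivalent v then 1 else 0) \<and>
    0 \<notin> set (snd e)"
  by (cases e) (simp add: move_params_def points_affine_torus)

lemma length_vertex_lift: "\<not> is_Cap v \<Longrightarrow> length (vertex_lift v y e) = length (move_source v)"
  by (cases v) auto

lemma vertex_read_lift:
  assumes "e \<in> points (move_params v)"
  shows "vertex_read v (vertex_lift v y e) = e"
  using assms by (cases e; cases v) (auto simp: points_move_params length_Suc_conv)

lemma vertex_equation_triangular_iff:
  assumes "is_Trivalent v \<or> is_Cup v" "braid_word n (move_source v)"
    and len: "length x = length (move_source v)" "length y = length (move_target v)"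
  shows "U \<in> borel_subgroup n \<and> braid_mat n (move_source v) x = U * braid_mat n (move_target v) y \<longleftrightarrow>
    U = vertex_mat n v x y \<and> vertex_read v x \<in> points (move_params v) \<and>
    x = vertex_lift v y (vertex_read v x)"
proof (cases v)
  case (Trivalent i)
  then obtain j where j: "i = Suc j" "Suc j < n"
    using assms(2) Suc_letter[of i n] by (auto simp: braid_word_def)
  obtain a b c where xy: "x = [a, b]" "y = [c]"
    using len Trivalent by (auto simp: length_Suc_conv numeral_2_eq_2)
  have M: "vertex_mat n v x y = braid_gen n i a * braid_gen n i b * braid_gen_inv n i c"
    using Trivalent xy by (simp add: right_mult_one_mat[of _ n n])
  have "U \<in> borel_subgroup n \<and> braid_mat n (move_source v) x = U * braid_mat n (move_target v) y \<longleftrightarrow>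
      U \<in> borel_subgroup n \<and> U = vertex_mat n v x y"
    using mult_braid_gen_eq_iff[of i n "braid_gen n i a * braid_gen n i b" U c] j xy Trivalent
    unfolding M by (auto simp: right_mult_one_mat[of _ n n] dest: borel_subgroup_carrier)
  also have "\<dots> \<longleftrightarrow> U = vertex_mat n v x y \<and> a * (c - b) = 1"
    using trivalent_borel_iff[OF j(2), of a b c] j(1) unfolding M by auto
  also have "a * (c - b) = 1 \<longleftrightarrow> a \<noteq> 0 \<and> b = c - 1 / a"
  proof (cases "a = 0")
    case False
    then have "a * (c - b) = 1 \<longleftrightarrow> c - b = 1 / a" by (simp add: eq_divide_eq mult.commute)
    then show ?thesis using False by (auto simp: algebra_simps)
  qed simp
  finally show ?thesis
    using Trivalent xy by (auto simp: points_move_params)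
next
  case (Cup i)
  then obtain j where j: "i = Suc j" "Suc j < n"
    using assms(2) Suc_letter[of i n] by (auto simp: braid_word_def)
  obtain a b where xy: "x = [a, b]" "y = []"
    using len Cup by (auto simp: length_Suc_conv numeral_2_eq_2)
  have M: "vertex_mat n v x y = braid_gen n i a * braid_gen n i b"
    using Cup xy by (simp add: right_mult_one_mat[of _ n n])
  have "U \<in> borel_subgroup n \<and> braid_mat n (move_source v) x = U * braid_mat n (move_target v) y \<longleftrightarrow>
      U \<in> borel_subgroup n \<and> U = vertex_mat n v x y"
    using xy Cup
    unfolding M by (auto simp: right_mult_one_mat[of _ n n] dest: borel_subgroup_carrier)
  also have "\<dots> \<longleftrightarrow> U = vertex_mat n v x y \<and> a = 0"
    using cup_borel_iff[OF j(2), of a b] j(1) unfolding M by auto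
  finally show ?thesis
    using Cup xy by (auto simp: points_move_params)
qed (use assms(1) in auto)

lemma vertex_equation_equal_iff:
  assumes "\<not> (is_Trivalent v \<or> is_Cup v \<or> is_Cap v)" "valid_move v" "braid_word n (move_source v)"
    and len: "length x = length (move_source v)" "length y = length (move_target v)"
  shows "braid_mat n (move_source v) x = braid_mat n (move_target v) y \<longleftrightarrow> x = vertex_lift v y e"
proof (cases v)
  case (Six i j)
  obtain a b c where x: "x = [a, b, c]"
    using len Six by (auto simp: length_Suc_conv numeral_3_eq_3)
  obtain p q t where y: "y = [p, q, t]"
    using len Six by (auto simp: length_Suc_conv numeral_3_eq_3)
  have letters: "1 \<le> i" "i < n" "1 \<le> j" "j < n" using assms(3) Six by (auto simp: braid_word_def)
  have mats: "braid_mat n (move_source v) x = braid_gen n i a * braid_gen n j b * braid_gen n i c"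
    "braid_mat n (move_target v) y = braid_gen n j p * braid_gen n i q * braid_gen n j t"
    using Six x y by (simp_all add: right_mult_one_mat[of _ n n] assoc_mult_mat[of _ n n _ n _ n])
  consider "j = Suc i" | "i = Suc j" using assms(2) Six by auto
  then show ?thesis
  proof cases
    case 1
    obtain k where k: "i = Suc k" "Suc k < n" using Suc_letter letters(1,2) by blast
    have n: "Suc (Suc k) < n" using 1 k letters by simp
    show ?thesis
      unfolding mats unfolding 1 k(1)
      unfolding braid_mat_up_down_up[OF n] braid_mat_down_up_down[OF n] braid_relation_mat_eq_iff[OF n]
      using Six 1 k x y by auto
  next
    case 2
    obtain k where k: "j = Suc k" "Suc k < n" using Suc_letter letters(3,4) by blast
    have n: "Suc (Suc k) < n" using 2 k letters by simp
    show ?thesis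
      unfolding mats unfolding 2 k(1)
      unfolding braid_mat_up_down_up[OF n] braid_mat_down_up_down[OF n] braid_relation_mat_eq_iff[OF n]
      using Six 2 k x y by (auto simp: algebra_simps)
  qed
next
  case (Four i j)
  obtain a b where x: "x = [a, b]"
    using len Four by (auto simp: length_Suc_conv numeral_2_eq_2)
  obtain p q where y: "y = [p, q]"
    using len Four by (auto simp: length_Suc_conv numeral_2_eq_2)
  have letters: "1 \<le> i" "i < n" "1 \<le> j" "j < n" using assms(3) Four by (auto simp: braid_word_def)
  obtain k l where kl: "i = Suc k" "Suc k < n" "j = Suc l" "Suc l < n"
    using Suc_letter letters by metis
  have far: "Suc k < l \<or> Suc l < k" using assms(2) Four kl by auto
  show ?thesis
    using distant_letters_commute_iff[OF kl(2,4) far, of a b p q] Four x y kl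
    by (auto simp: right_mult_one_mat[of _ n n])
qed (use assms(1) in auto)

text \<open>
  This is the determinism of the vertices in the forward direction: each of the solution formulas
  can be solved for the new variables once the parameter is known.
\<close>

lemma vertex_lift_inj:
  assumes "\<not> is_Cap v" "e \<in> points (move_params v)"
    and "length y = length (move_target v)" "length y' = length (move_target v)"
    and "vertex_lift v y e = vertex_lift v y' e"
  shows "y = y'"
  using assms
  by (cases v) (auto simp: length_Suc_conv numeral_2_eq_2 numeral_3_eq_3 split: if_splits)

text \<open>
  A step applied behind the letters \<open>l\<close> is solved backwards from the new variables and the
  parameter of the move: the local equation gives the old variables at the move, and the matrix that it
  produces is pushed through \<open>l\<close> from right to left.
\<close>

definition step_lift ::
  "nat \<Rightarrow> nat list \<Rightarrow> move \<Rightarrow> complex list \<Rightarrow> complex list \<times> complex list \<Rightarrow> complex list \<times> complex mat list" where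
  "step_lift n l v z' e =
    (let zl' = take (length l) z'; y = take (length (move_target v)) (drop (length l) z');
         x = vertex_lift v y e;
         S = (if is_Trivalent v \<or> is_Cup v then slide_back n l zl' (vertex_mat n v x y) else (zl', []))
     in (fst S @ x @ drop (length l + length (move_target v)) z', snd S))"

lemma length_slide_back: "length (fst (slide_back n l z' V)) = length l"
  by (induction l arbitrary: z') (auto simp: Let_def case_prod_beta)

definition step_read :: "nat list \<Rightarrow> move \<Rightarrow> complex list \<Rightarrow> complex list \<times> complex list" where
  "step_read l v z = vertex_read v (take (length (move_source v)) (drop (length l) z))"

lemma step_relation_append:
  assumes "\<not> is_Cap v" "length zl = length l" "length zl' = length l"
    and "length x = length (move_source v)" "length y = length (move_target v)"
  shows "step_relation n (l @ move_source v @ r) (length l, v) (zl @ x @ zr) (zl' @ y @ zr') U \<longleftrightarrow>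
    zr = zr' \<and>
    (if is_Trivalent v \<or> is_Cup v
     then slides n l zl zl' U \<and> braid_mat n (move_source v) x = last U * braid_mat n (move_target v) y
     else zl = zl' \<and> U = [] \<and> braid_mat n (move_source v) x = braid_mat n (move_target v) y)"
proof -
  have ball: "(\<forall>q\<in>{1..length l}. braid_gen n ((l @ s) ! (q - 1)) ((zl @ t) ! (q - 1)) * U ! q =
        U ! (q - 1) * braid_gen n ((l @ s) ! (q - 1)) ((zl' @ t') ! (q - 1))) \<longleftrightarrow>
      (\<forall>q\<in>{1..length l}. braid_gen n (l ! (q - 1)) (zl ! (q - 1)) * U ! q =
        U ! (q - 1) * braid_gen n (l ! (q - 1)) (zl' ! (q - 1)))" for s t t'
    using assms(2,3) by (intro ball_cong refl) (auto simp: nth_append)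
  have last: "U ! length l = last U" if "length U = Suc (length l)"
    using that by (metis diff_Suc_1 last_conv_nth list.size(3) nat.simps(3))
  show ?thesis
  proof (cases "is_Trivalent v \<or> is_Cup v")
    case True
    then show ?thesis
      using assms last unfolding step_relation_def Let_def prod.case ball slides_iff
      by (auto simp: num_matrices_def)
  next
    case False
    then show ?thesis
      using assms unfolding step_relation_def Let_def prod.case
      by (auto simp: num_matrices_def)
  qed
qed

lemma split_list_by_lengths:
  assumes "length z = length a + length b + length c"
  obtains x y t where "z = x @ y @ t" "length x = length a" "length y = length b" "length t = length c"
proof (rule that)
  show "z = take (length a) z @ take (length b) (drop (length a) z) @ drop (length a + length b) z"
    by (metis append_take_drop_id drop_drop add.commute)
qed (use assms in auto)

lemma length_step_lift:
  assumes "\<not> is_Cap v" "length z' = length (l @ move_target v @ r)"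
  shows "length (fst (step_lift n l v z' e)) = length (l @ move_source v @ r)"
  using assms by (simp add: step_lift_def Let_def length_slide_back length_vertex_lift)

text \<open>
  The points over given new variables correspond to the points of the parameter variety; the
  letters to the right of the move contribute nothing.
\<close>

lemma step_relation_iff_lift:
  assumes "\<not> is_Cap v" "valid_move v" "braid_word n (l @ move_source v @ r)"
    and len: "length z' = length (l @ move_target v @ r)"
  shows "length z = length (l @ move_source v @ r) \<and>
      step_relation n (l @ move_source v @ r) (length l, v) z z' U \<longleftrightarrow>
    step_read l v z \<in> points (move_params v) \<and> (z, U) = step_lift n l v z' (step_read l v z)"
proof -
  obtain zl' y zr' where z': "z' = zl' @ y @ zr'" "length zl' = length l"
    "length y = length (move_target v)" "length zr' = length r"
    using split_list_by_lengths[of z' l "move_target v" r] len by auto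
  have l: "braid_word n l" and src: "braid_word n (move_source v)"
    using assms(3) by (auto simp: braid_word_def)
  have lift: "step_lift n l v z' e =
    (let x = vertex_lift v y e;
         S = (if is_Trivalent v \<or> is_Cup v then slide_back n l zl' (vertex_mat n v x y) else (zl', []))
     in (fst S @ x @ zr', snd S))" for e
    using z' by (simp add: step_lift_def)
  show ?thesis
  proof (cases "length z = length (l @ move_source v @ r)")
    case False
    then show ?thesis using length_step_lift[OF assms(1) len, of n] by (metis fst_conv)
  next
    case True
    then obtain zl x zr where z: "z = zl @ x @ zr" "length zl = length l"
      "length x = length (move_source v)" "length zr = length r"
      using split_list_by_lengths[of z l "move_source v" r] by auto
    have read: "step_read l v z = vertex_read v x" using z by (simp add: step_read_def)
    note rel = step_relation_append[OF assms(1) z(2) z'(2) z(3) z'(3), of n r zr zr' U, folded z(1) z'(1)]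
    have eqz: "(z, U) = (fst S @ x' @ zr', snd S) \<longleftrightarrow> zr = zr' \<and> x = x' \<and> (zl, U) = S"
      if "length (fst S) = length l" "length x' = length (move_source v)" for S x'
      using that z by (cases S) auto
    show ?thesis
    proof (cases "is_Trivalent v \<or> is_Cup v")
      case tri: True
      have "slides n l zl zl' U \<and> braid_mat n (move_source v) x = last U * braid_mat n (move_target v) y \<longleftrightarrow>
          slides n l zl zl' U \<and> last U = vertex_mat n v x y \<and>
          vertex_read v x \<in> points (move_params v) \<and> x = vertex_lift v y (vertex_read v x)"
        using vertex_equation_triangular_iff[OF tri src z(3) z'(3), of "last U"] slides_borel(2) by blast
      also have "\<dots> \<longleftrightarrow> (zl, U) = slide_back n l zl' (vertex_mat n v x y) \<and>
          vertex_read v x \<in> points (move_params v) \<and> x = vertex_lift v y (vertex_read v x)"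
        using slides_iff_slide_back[OF l, of zl zl' U "vertex_mat n v x y"] z'(2)
          vertex_equation_triangular_iff[OF tri src z(3) z'(3), of "vertex_mat n v x y"] by blast
      finally show ?thesis
        unfolding lift read Let_def rel using tri True
          eqz[of "slide_back n l zl' (vertex_mat n v (vertex_lift v y (vertex_read v x)) y)",
            OF length_slide_back length_vertex_lift[OF assms(1)]]
        by auto
    next
      case False
      have "braid_mat n (move_source v) x = braid_mat n (move_target v) y \<longleftrightarrow>
          x = vertex_lift v y (vertex_read v x)"
        using vertex_equation_equal_iff[OF _ assms(2) src z(3) z'(3)] False assms(1) by blast
      moreover have "vertex_read v x \<in> points (move_params v)"
        using False assms(1) by (cases v) (auto simp: points_move_params)
      ultimately show ?thesis
        unfolding lift read Let_def rel using False True z'(2)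
          eqz[of "(zl', [])", OF _ length_vertex_lift[OF assms(1)]]
        by auto
    qed
  qed
qed

lemma step_read_lift:
  assumes "\<not> is_Cap v" "length z' = length (l @ move_target v @ r)" "e \<in> points (move_params v)"
  shows "step_read l v (fst (step_lift n l v z' e)) = e"
proof -
  show ?thesis
    using assms length_vertex_lift[OF assms(1)]
    by (simp add: step_read_def step_lift_def Let_def vertex_read_lift length_slide_back)
qed

lemma step_relation_forward_unique:
  assumes v: "\<not> is_Cap v" "valid_move v" and word: "braid_word n (l @ move_source v @ r)"
    and len: "length z = length (l @ move_source v @ r)" "length z' = length (l @ move_target v @ r)"
      "length z'' = length (l @ move_target v @ r)"
    and rel: "step_relation n (l @ move_source v @ r) (length l, v) z z' U"
      "step_relation n (l @ move_source v @ r) (length l, v) z z'' U'"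
  shows "z' = z'' \<and> U = U'"
proof -
  obtain zl x zr where z: "z = zl @ x @ zr" "length zl = length l"
    "length x = length (move_source v)" "length zr = length r"
    using split_list_by_lengths[of z l "move_source v" r] len by auto
  obtain zl' y zr' where z': "z' = zl' @ y @ zr'" "length zl' = length l"
    "length y = length (move_target v)" "length zr' = length r"
    using split_list_by_lengths[of z' l "move_target v" r] len by auto
  obtain zl'' y' zr'' where z'': "z'' = zl'' @ y' @ zr''" "length zl'' = length l"
    "length y' = length (move_target v)" "length zr'' = length r"
    using split_list_by_lengths[of z'' l "move_target v" r] len by auto
  have l: "braid_word n l" and src: "braid_word n (move_source v)"
    using word by (auto simp: braid_word_def)
  note rels = rel[unfolded z(1) z'(1) z''(1)
      step_relation_append[OF v(1) z(2) z'(2) z(3) z'(3)] step_relation_append[OF v(1) z(2) z''(2) z(3) z''(3)]]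
  show ?thesis
  proof (cases "is_Trivalent v \<or> is_Cup v")
    case True
    then have slides: "slides n l zl zl' U" "slides n l zl zl'' U'" using rels by auto
    have 1: "last U = vertex_mat n v x y" "vertex_read v x \<in> points (move_params v)"
      "x = vertex_lift v y (vertex_read v x)"
      using vertex_equation_triangular_iff[OF True src z(3) z'(3), of "last U"]
        slides_borel(2)[OF slides(1)] rels(1) True by auto
    have 2: "last U' = vertex_mat n v x y'" "x = vertex_lift v y' (vertex_read v x)"
      using vertex_equation_triangular_iff[OF True src z(3) z''(3), of "last U'"]
        slides_borel(2)[OF slides(2)] rels(2) True by auto
    have y: "y = y'" using vertex_lift_inj[OF v(1) 1(2) z'(3) z''(3)] 1(3) 2(2) by simp
    then show ?thesis
      using slides_forward_unique[OF l slides] 1(1) 2(1) rels z' z'' by auto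
  next
    case False
    then have "x = vertex_lift v y (vertex_read v x)" "x = vertex_lift v y' (vertex_read v x)"
      using vertex_equation_equal_iff[OF _ v(2) src z(3) z'(3)]
        vertex_equation_equal_iff[OF _ v(2) src z(3) z''(3)] v(1) rels by auto
    moreover have "vertex_read v x \<in> points (move_params v)"
      using False v(1) by (cases v) (auto simp: points_move_params)
    ultimately have "y = y'" using vertex_lift_inj[OF v(1) _ z'(3) z''(3)] by simp
    then show ?thesis using rels False z' z'' by auto
  qed
qed

text \<open>
  A step changes the braid matrix only by a triangular factor on the left, which does not affect
  whether its product with a permutation matrix is triangular. Hence the source of a weave
  stays in the braid variety.
\<close>

lemma step_relation_braid_mat:
  assumes v: "\<not> is_Cap v"
    and len: "length z = length (l @ move_source v @ r)" "length z' = length (l @ move_target v @ r)"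
    and rel: "step_relation n (l @ move_source v @ r) (length l, v) z z' U"
  obtains V where "V \<in> borel_subgroup n"
    "braid_mat n (l @ move_source v @ r) z = V * braid_mat n (l @ move_target v @ r) z'"
proof -
  obtain zl x zr where z: "z = zl @ x @ zr" "length zl = length l"
    "length x = length (move_source v)" "length zr = length r"
    using split_list_by_lengths[of z l "move_source v" r] len by auto
  obtain zl' y zr' where z': "z' = zl' @ y @ zr'" "length zl' = length l"
    "length y = length (move_target v)" "length zr' = length r"
    using split_list_by_lengths[of z' l "move_target v" r] len by auto
  note rels = rel[unfolded z(1) z'(1) step_relation_append[OF v(1) z(2) z'(2) z(3) z'(3)]]
  let ?L = "braid_mat n l zl" and ?X = "braid_mat n (move_source v) x" and ?R = "braid_mat n r zr"
    and ?L' = "braid_mat n l zl'" and ?Y = "braid_mat n (move_target v) y"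
  have carrier: "?L \<in> carrier_mat n n" "?X \<in> carrier_mat n n" "?R \<in> carrier_mat n n"
    "?L' \<in> carrier_mat n n" "?Y \<in> carrier_mat n n"
    using z z' by simp_all
  have M: "braid_mat n (l @ move_source v @ r) z = ?L * (?X * ?R)"
    using z by (simp add: braid_mat_append)
  have M': "braid_mat n (l @ move_target v @ r) z' = ?L' * (?Y * ?R)"
    using z z' rels by (simp add: braid_mat_append)
  show ?thesis
  proof (cases "is_Trivalent v \<or> is_Cup v")
    case True
    then have slides: "slides n l zl zl' U" and X: "?X = last U * ?Y" using rels by auto
    note U = slides_borel[OF slides, THEN borel_subgroup_carrier]
    have "?L * (?X * ?R) = (?L * last U) * (?Y * ?R)"
      unfolding X using carrier U by (simp add: assoc_mult_mat[of _ n n _ n _ n])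
    also have "\<dots> = hd U * (?L' * (?Y * ?R))"
      unfolding slides_braid_mat[OF slides] using carrier U by (simp add: assoc_mult_mat[of _ n n _ n _ n])
    finally show ?thesis using that[OF slides_borel(1)[OF slides]] M M' by simp
  next
    case False
    then have "braid_mat n (l @ move_source v @ r) z = 1\<^sub>m n * braid_mat n (l @ move_target v @ r) z'"
      using M M' rels carrier by (simp add: left_mult_one_mat[of _ n n])
    moreover have "1\<^sub>m n \<in> borel_subgroup n" by (simp add: borel_subgroup_iff)
    ultimately show ?thesis using that by blast
  qed
qed

lemma step_read_regular:
  assumes "regular_list V (length (l @ move_source v @ r)) z"
    and "\<And>p. p \<in> points V \<Longrightarrow> step_read l v (z p) \<in> points (move_params v)"
  shows "regular_map V (move_params v) (\<lambda>p. step_read l v (z p))"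
proof -
  have "regular_list V (length (move_source v)) (\<lambda>p. take (length (move_source v)) (drop (length l) (z p)))"
    by (rule regular_list_take[OF regular_list_drop[OF assms(1)]]) simp
  note nth = regular_list_nth[OF this]
  have "regular_list V (if is_Cup v then 1 else 0) (\<lambda>p. fst (step_read l v (z p)))"
    "regular_list V (if is_Trivalent v then 1 else 0) (\<lambda>p. snd (step_read l v (z p)))"
    using nth[of 0] nth[of 1] by (cases v; simp add: step_read_def regular_list_def)+
  then have "regular_map V (move_params v) (\<lambda>p. (fst (step_read l v (z p)), snd (step_read l v (z p))))"
    unfolding move_params_def using assms(2)
    by (intro regular_map_affine_torus) (auto simp: points_move_params)
  then show ?thesis by simp
qed

lemma step_lift_regular:
  assumes v: "\<not> is_Cap v" "valid_move v" and word: "braid_word n (l @ move_source v @ r)"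
    and z': "regular_list V (length (l @ move_target v @ r)) z'"
    and e: "regular_map V (move_params v) e"
  shows "regular_list V (length (l @ move_source v @ r)) (\<lambda>p. fst (step_lift n l v (z' p) (e p)))"
    and "q < num_matrices (length l, v) \<Longrightarrow> regular_mat V n (\<lambda>p. snd (step_lift n l v (z' p) (e p)) ! q)"
proof -
  define zl where "zl = (\<lambda>p. take (length l) (z' p))"
  define y where "y = (\<lambda>p. take (length (move_target v)) (drop (length l) (z' p)))"
  define zr where "zr = (\<lambda>p. drop (length l + length (move_target v)) (z' p))"
  define x where "x = (\<lambda>p. vertex_lift v (y p) (e p))"
  define M where "M = (\<lambda>p. vertex_mat n v (x p) (y p))"
  have l: "braid_word n l" and src: "braid_word n (move_source v)"
    using word by (auto simp: braid_word_def)
  have zl: "regular_list V (length l) zl"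
    unfolding zl_def by (rule regular_list_take[OF z']) simp
  have y: "regular_list V (length (move_target v)) y"
    unfolding y_def by (rule regular_list_take[OF regular_list_drop[OF z']]) simp
  have zr: "regular_list V (length r) zr"
    using regular_list_drop[OF z', of "length l + length (move_target v)"] by (simp add: zr_def)
  have pt: "e p \<in> points (move_params v)" if "p \<in> points V" for p
    using e that by (auto simp: regular_map_def)
  note e' = regular_list_affine_torus[OF e[unfolded move_params_def]]
  have x: "regular_list V (length (move_source v)) x"
  proof (cases v)
    case (Trivalent i)
    have "snd (e p) ! 0 \<noteq> 0" if "p \<in> points V" for p
      using pt[OF that] Trivalent by (auto simp: points_move_params length_Suc_conv)
    then show ?thesis
      using Trivalent regular_list_nth[OF y, of 0] regular_list_nth[OF e'(2), of 0]
      by (auto simp: x_def intro!: regular_list_Cons[of V _ 1, simplified] regular_list_Cons[of V _ 0, simplified]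
          regular_list_Nil regular_function_diff regular_function_inverse)
  next
    case (Cup i)
    then show ?thesis
      using regular_list_nth[OF e'(1), of 0]
      by (auto simp: x_def intro!: regular_list_Cons[of V _ 1, simplified] regular_list_Cons[of V _ 0, simplified]
          regular_list_Nil regular_function_const)
  next
    case (Six i j)
    have "regular_list V (Suc (Suc (Suc 0))) x"
      unfolding x_def Six vertex_lift.simps using Six regular_list_nth[OF y]
      by (intro regular_list_Cons regular_list_Nil regular_function_if regular_function_add
          regular_function_diff regular_function_mult) auto
    then show ?thesis using Six by simp
  next
    case (Four i j)
    have "regular_list V (Suc (Suc 0)) x"
      unfolding x_def Four vertex_lift.simps using Four regular_list_nth[OF y]
      by (intro regular_list_Cons regular_list_Nil) auto
    then show ?thesis using Four by simp
  qed (use v(1) in auto)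
  have M: "regular_mat V n M" if "is_Trivalent v \<or> is_Cup v"
    using that regular_mat_braid_mat[OF x, of n] regular_list_nth[OF y, of 0]
    by (cases v) (auto simp: M_def intro!: regular_mat_mult regular_mat_braid_gen_inv)
  have M_borel: "M p \<in> borel_subgroup n" if "is_Trivalent v \<or> is_Cup v" "p \<in> points V" for p
  proof -
    have read: "vertex_read v (x p) = e p" unfolding x_def by (rule vertex_read_lift[OF pt[OF that(2)]])
    show ?thesis
      using vertex_equation_triangular_iff[OF that(1) src regular_list_length[OF x that(2)]
          regular_list_length[OF y that(2)], of "M p"] pt[OF that(2)]
      unfolding read by (simp add: M_def x_def)
  qed
  show "regular_list V (length (l @ move_source v @ r)) (\<lambda>p. fst (step_lift n l v (z' p) (e p)))"
  proof (cases "is_Trivalent v \<or> is_Cup v")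
    case True
    have "regular_list V (length l + (length (move_source v) + length r))
        (\<lambda>p. fst (slide_back n l (zl p) (M p)) @ x p @ zr p)"
      by (intro regular_list_append slide_back_regular l zl x zr M M_borel True)
    then show ?thesis
      using True by (simp add: step_lift_def Let_def zl_def x_def y_def zr_def M_def)
  next
    case False
    have "regular_list V (length l + (length (move_source v) + length r)) (\<lambda>p. zl p @ x p @ zr p)"
      by (intro regular_list_append zl x zr)
    then show ?thesis
      using False by (simp add: step_lift_def Let_def zl_def x_def y_def zr_def)
  qed
  show "regular_mat V n (\<lambda>p. snd (step_lift n l v (z' p) (e p)) ! q)"
    if "q < num_matrices (length l, v)"
  proof -
    have True: "is_Trivalent v \<or> is_Cup v" and q: "q \<le> length l"
      using that v(1) by (auto simp: num_matrices_def split: if_splits)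
    have "regular_mat V n (\<lambda>p. snd (slide_back n l (zl p) (M p)) ! q)"
      by (intro slide_back_regular l zl M M_borel True q)
    then show ?thesis
      using True by (simp add: step_lift_def Let_def zl_def x_def y_def zr_def M_def)
  qed
qed

section \<open>The correspondence of a weave\<close>

definition isomorphic_varieties ::
  "('p, 'x) variety_scheme \<Rightarrow> ('q, 'y) variety_scheme \<Rightarrow> bool" (infix "\<cong>\<^sub>v" 50) where
  "V \<cong>\<^sub>v W \<longleftrightarrow> (\<exists>f. variety_iso V W f)"

lemma isomorphic_varietiesI: "variety_iso V W f \<Longrightarrow> V \<cong>\<^sub>v W"
  by (auto simp: isomorphic_varieties_def)

lemma isomorphic_varieties_sym: "V \<cong>\<^sub>v W \<Longrightarrow> W \<cong>\<^sub>v V"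
  unfolding isomorphic_varieties_def variety_iso_def by blast

lemma isomorphic_varieties_trans [trans]: "V \<cong>\<^sub>v W \<Longrightarrow> W \<cong>\<^sub>v X \<Longrightarrow> V \<cong>\<^sub>v X"
  unfolding isomorphic_varieties_def using variety_iso_comp by blast

lemma isomorphic_prod_left: "V \<cong>\<^sub>v W \<Longrightarrow> prod_variety V X \<cong>\<^sub>v prod_variety W X"
  unfolding isomorphic_varieties_def by (blast intro: variety_iso_prod_left)

lemma isomorphic_prod_point:
  assumes "points X = {x}"
  shows "prod_variety X V \<cong>\<^sub>v V"
proof (rule isomorphic_varietiesI[OF variety_isoI[OF regular_map_snd]])
  have "regular_map V X (\<lambda>_. x)"
    by (rule regular_mapI) (simp_all add: assms regular_function_const)
  moreover have "regular_map V V (\<lambda>y. y)"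
    by (rule regular_mapI) (simp_all add: regular_function_coord)
  ultimately show "regular_map V (prod_variety X V) (\<lambda>y. (x, y))"
    by (rule regular_map_Pair)
qed (use assms in auto)

lemma is_weave_ConsE:
  assumes "is_weave n \<gamma> \<beta> \<lparr>words = ws, steps = s # S\<rparr>"
  obtains W l v r where "ws = \<gamma> # W" "s = (length l, v)" "valid_move v"
    "\<gamma> = l @ move_source v @ r" "braid_word n \<gamma>"
    "length W = Suc (length S)" "W ! 0 = l @ move_target v @ r"
    "is_weave n (l @ move_target v @ r) \<beta> \<lparr>words = W, steps = S\<rparr>"
proof -
  have w: "length ws = Suc (Suc (length S))" "\<forall>\<gamma>\<in>set ws. braid_word n \<gamma>" "ws ! 0 = \<gamma>"
    "ws ! Suc (length S) = \<beta>"
    "\<And>j. j < Suc (length S) \<Longrightarrow> is_step (ws ! j) ((s # S) ! j) (ws ! Suc j)"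
    using assms by (auto simp: is_weave_def)
  from w(1,3) obtain W where W: "ws = \<gamma> # W" "length W = Suc (length S)" by (cases ws) auto
  obtain l v r where s: "s = (length l, v)" "valid_move v" "\<gamma> = l @ move_source v @ r"
    "W ! 0 = l @ move_target v @ r"
    using w(5)[of 0] W by (auto simp: is_step_def split: prod.splits)
  have "is_step (W ! j) (S ! j) (W ! Suc j)" if "j < length S" for j
    using w(5)[of "Suc j"] that W by simp
  then have "is_weave n (W ! 0) \<beta> \<lparr>words = W, steps = S\<rparr>"
    using w(2,4) W by (auto simp: is_weave_def)
  then show ?thesis using that[OF W(1) s(1,2,3) _ W(2) s(4)] w(2) W s(4) by simp
qed

lemma is_weave_NilE:
  assumes "is_weave n \<gamma> \<beta> \<lparr>words = ws, steps = []\<rparr>"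
  obtains "ws = [\<beta>]" "\<gamma> = \<beta>"
  using assms by (cases ws) (auto simp: is_weave_def)

lemma correspondence_points_Cons:
  assumes "length W = Suc (length S)"
  shows "(zs, Us) \<in> correspondence_points n \<lparr>words = \<gamma> # W, steps = s # S\<rparr> \<longleftrightarrow>
    (\<exists>z zs' U Us'. zs = z # zs' \<and> Us = U # Us' \<and> length z = length \<gamma> \<and> length (zs' ! 0) = length (W ! 0) \<and>
       step_relation n \<gamma> s z (zs' ! 0) U \<and> (zs', Us') \<in> correspondence_points n \<lparr>words = W, steps = S\<rparr>)"
proof (cases "\<exists>z zs' U Us'. zs = z # zs' \<and> Us = U # Us'")
  case True
  then obtain z zs' U Us' where eq: "zs = z # zs'" "Us = U # Us'" by blast
  show ?thesis
    unfolding eq using assms by (auto simp: correspondence_points_def All_less_Suc2)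
next
  case False
  then have "zs = [] \<or> Us = []" by (meson list.exhaust)
  then show ?thesis by (auto simp: correspondence_points_def)
qed

lemma closed_correspondence_points_Cons:
  assumes "length W = Suc (length S)"
  shows "(zs, Us) \<in> points (closed_correspondence n \<lparr>words = \<gamma> # W, steps = s # S\<rparr> \<pi>) \<longleftrightarrow>
    (\<exists>z zs' U Us'. zs = z # zs' \<and> Us = U # Us' \<and> length z = length \<gamma> \<and> length (zs' ! 0) = length (W ! 0) \<and>
       step_relation n \<gamma> s z (zs' ! 0) U \<and>
       (zs', Us') \<in> points (closed_correspondence n \<lparr>words = W, steps = S\<rparr> \<pi>))"
  by (auto simp: closed_correspondence_def correspondence_def target_map_def
      correspondence_points_Cons[OF assms])

lemma regular_list_correspondence:
  assumes "j < length (words w)"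
  shows "regular_list (closed_correspondence n w \<pi>) (length (words w ! j)) (\<lambda>P. fst P ! j)"
proof (rule regular_listI)
  fix P assume "P \<in> points (closed_correspondence n w \<pi>)"
  then show "length (fst P ! j) = length (words w ! j)"
    using assms by (auto simp: closed_correspondence_def correspondence_def correspondence_points_def)
next
  fix k assume "k < length (words w ! j)"
  then show "regular_function (closed_correspondence n w \<pi>) (\<lambda>P. fst P ! j ! k)"
    using assms
    by (intro regular_function_coord)
      (auto simp: closed_correspondence_def correspondence_def correspondence_coords_def case_prod_beta')
qed

lemma regular_entry_correspondence:
  assumes "j < length (steps w)" "q < num_matrices (steps w ! j)" "r < n" "c < n"
  shows "regular_function (closed_correspondence n w \<pi>) (\<lambda>P. (snd P ! j ! q) $$ (r, c))"
  using assms
  by (intro regular_function_coord)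
    (force simp: closed_correspondence_def correspondence_def correspondence_coords_def case_prod_beta')

lemma regular_map_closed_correspondence:
  assumes "\<And>p. p \<in> points V \<Longrightarrow> f p \<in> points (closed_correspondence n w \<pi>)"
    and "\<And>j k. j < length (words w) \<Longrightarrow> k < length (words w ! j) \<Longrightarrow>
      regular_function V (\<lambda>p. fst (f p) ! j ! k)"
    and "\<And>j q r c. j < length (steps w) \<Longrightarrow> q < num_matrices (steps w ! j) \<Longrightarrow> r < n \<Longrightarrow> c < n \<Longrightarrow>
      regular_function V (\<lambda>p. (snd (f p) ! j ! q) $$ (r, c))"
  shows "regular_map V (closed_correspondence n w \<pi>) f"
proof (rule regular_mapI[OF assms(1)])
  fix c assume "c \<in> coords (closed_correspondence n w \<pi>)"
  then show "regular_function V (\<lambda>p. c (f p))"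
    using assms(2,3)
    by (auto simp: closed_correspondence_def correspondence_def correspondence_coords_def case_prod_beta)
qed

text \<open>
  The first step of a weave is solved backwards over the correspondence of the remaining
  steps, which contributes one factor of parameters.
\<close>

lemma closed_correspondence_Cons_isomorphic:
  assumes \<gamma>: "\<gamma> = l @ move_source v @ r" and word: "braid_word n \<gamma>"
    and v: "valid_move v" "\<not> is_Cap v"
    and W: "length W = Suc (length S)" "W ! 0 = l @ move_target v @ r"
  shows "closed_correspondence n \<lparr>words = \<gamma> # W, steps = (length l, v) # S\<rparr> \<pi> \<cong>\<^sub>v
    prod_variety (closed_correspondence n \<lparr>words = W, steps = S\<rparr> \<pi>) (move_params v)"
proof -
  let ?w = "\<lparr>words = \<gamma> # W, steps = (length l, v) # S\<rparr>" and ?w' = "\<lparr>words = W, steps = S\<rparr>"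
  let ?V = "closed_correspondence n ?w \<pi>" and ?V' = "closed_correspondence n ?w' \<pi>"
  let ?P = "prod_variety ?V' (move_params v)"
  define f where "f = (\<lambda>P :: weave_data. ((tl (fst P), tl (snd P)), step_read l v (fst P ! 0)))"
  define g where "g = (\<lambda>p. let S = step_lift n l v (fst (fst p) ! 0) (snd p)
    in (fst S # fst (fst p), snd S # snd (fst p)) :: weave_data)"
  have len0: "length (fst P ! 0) = length (l @ move_target v @ r)" if "P \<in> points ?V'" for P
    using regular_list_length[OF regular_list_correspondence[of 0 ?w'] that] W by simp
  have Cons: "P \<in> points ?V \<longleftrightarrow> (\<exists>z zs U Us. P = (z # zs, U # Us) \<and>
       (zs, Us) \<in> points ?V' \<and> step_read l v z \<in> points (move_params v) \<and>
       (z, U) = step_lift n l v (zs ! 0) (step_read l v z))" for P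
  proof -
    have "length z = length \<gamma> \<and> length (zs ! 0) = length (W ! 0) \<and>
        step_relation n \<gamma> (length l, v) z (zs ! 0) U \<and> (zs, Us) \<in> points ?V' \<longleftrightarrow>
      (zs, Us) \<in> points ?V' \<and> step_read l v z \<in> points (move_params v) \<and>
        (z, U) = step_lift n l v (zs ! 0) (step_read l v z)" for z zs U Us
      using step_relation_iff_lift[OF v(2,1) word[unfolded \<gamma>], of "zs ! 0" z U] len0[of "(zs, Us)"] W(2)
      unfolding \<gamma> by auto
    then show ?thesis
      using closed_correspondence_points_Cons[OF W(1), of "fst P" "snd P" n \<gamma> "(length l, v)" \<pi>]
      by (cases P) auto
  qed
  have f_points: "f P \<in> points ?P" if "P \<in> points ?V" for P
    using that unfolding Cons by (auto simp: f_def)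
  have gf: "g (f P) = P" if "P \<in> points ?V" for P
    using that unfolding Cons by (auto simp: f_def g_def Let_def) (metis fst_conv snd_conv)+
  have g_points: "g p \<in> points ?V" and fg: "f (g p) = p" if p: "p \<in> points ?P" for p
  proof -
    obtain zs Us e where p': "p = ((zs, Us), e)" "(zs, Us) \<in> points ?V'" "e \<in> points (move_params v)"
      using p by auto
    have "step_read l v (fst (step_lift n l v (zs ! 0) e)) = e"
      using step_read_lift[OF v(2) _ p'(3), of "zs ! 0" l r] len0[OF p'(2)] by simp
    then show "g p \<in> points ?V" "f (g p) = p"
      using p' unfolding Cons by (auto simp: f_def g_def Let_def)
  qed
  have "regular_map ?V ?P f"
    unfolding f_def
  proof (rule regular_map_Pair)
    have tl_points: "(tl (fst P), tl (snd P)) \<in> points ?V'" if "P \<in> points ?V" for P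
      using f_points[OF that] by (simp add: f_def)
    have len: "length (fst P) = Suc (length W)" "length (snd P) = Suc (length S)"
      if "P \<in> points ?V" for P
      using that by (auto simp: closed_correspondence_def correspondence_def correspondence_points_def)
    show "regular_map ?V ?V' (\<lambda>P. (tl (fst P), tl (snd P)))"
    proof (rule regular_map_closed_correspondence[OF tl_points])
      fix j k assume jk: "j < length (words ?w')" "k < length (words ?w' ! j)"
      have "regular_function ?V (\<lambda>P. fst (tl (fst P), tl (snd P)) ! j ! k) \<longleftrightarrow>
          regular_function ?V (\<lambda>P. fst P ! Suc j ! k)"
        by (rule regular_function_cong) (use jk len in \<open>simp add: nth_tl\<close>)
      then show "regular_function ?V (\<lambda>P. fst (tl (fst P), tl (snd P)) ! j ! k)"
        using regular_list_nth[OF regular_list_correspondence[of "Suc j" ?w], of k] jk by simp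
    next
      fix j q r c assume jq: "j < length (steps ?w')" "q < num_matrices (steps ?w' ! j)" "r < n" "c < n"
      have "regular_function ?V (\<lambda>P. (snd (tl (fst P), tl (snd P)) ! j ! q) $$ (r, c)) \<longleftrightarrow>
          regular_function ?V (\<lambda>P. (snd P ! Suc j ! q) $$ (r, c))"
        by (rule regular_function_cong) (use jq len in \<open>simp add: nth_tl\<close>)
      then show "regular_function ?V (\<lambda>P. (snd (tl (fst P), tl (snd P)) ! j ! q) $$ (r, c))"
        using regular_entry_correspondence[of "Suc j" ?w q r n c] jq by simp
    qed
    show "regular_map ?V (move_params v) (\<lambda>P. step_read l v (fst P ! 0))"
    proof (rule step_read_regular)
      show "regular_list ?V (length (l @ move_source v @ r)) (\<lambda>P. fst P ! 0)"
        using regular_list_correspondence[of 0 ?w n \<pi>] \<gamma> by simp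
      show "step_read l v (fst P ! 0) \<in> points (move_params v)" if "P \<in> points ?V" for P
        using f_points[OF that] by (simp add: f_def)
    qed
  qed
  moreover have "regular_map ?P ?V g"
  proof (rule regular_map_closed_correspondence[OF g_points])
    have z0: "regular_list ?P (length (l @ move_target v @ r)) (\<lambda>p. fst (fst p) ! 0)"
      using regular_list_comp[OF regular_map_fst regular_list_correspondence[of 0 ?w' n \<pi>]] W by simp
    note lift = step_lift_regular[OF v(2,1) word[unfolded \<gamma>] z0 regular_map_snd]
    fix j k assume jk: "j < length (words ?w)" "k < length (words ?w ! j)"
    show "regular_function ?P (\<lambda>p. fst (g p) ! j ! k)"
    proof (cases j)
      case 0
      then show ?thesis using regular_list_nth[OF lift(1), of k] jk \<gamma> by (simp add: g_def Let_def)
    next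
      case (Suc i)
      then show ?thesis
        using regular_list_nth[OF regular_list_comp[OF regular_map_fst
              regular_list_correspondence[of i ?w' n \<pi>]], of k] jk
        by (simp add: g_def Let_def)
    qed
  next
    have z0: "regular_list ?P (length (l @ move_target v @ r)) (\<lambda>p. fst (fst p) ! 0)"
      using regular_list_comp[OF regular_map_fst regular_list_correspondence[of 0 ?w' n \<pi>]] W by simp
    note lift = step_lift_regular[OF v(2,1) word[unfolded \<gamma>] z0 regular_map_snd]
    fix j q r' c assume jq: "j < length (steps ?w)" "q < num_matrices (steps ?w ! j)" "r' < n" "c < n"
    show "regular_function ?P (\<lambda>p. (snd (g p) ! j ! q) $$ (r', c))"
    proof (cases j)
      case 0
      then show ?thesis using regular_mat_entry[OF lift(2), of q r' c] jq by (simp add: g_def Let_def)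
    next
      case (Suc i)
      then show ?thesis
        using regular_function_comp[OF regular_map_fst
            regular_entry_correspondence[of i ?w' q r' n c \<pi>]] jq
        by (simp add: g_def Let_def o_def)
    qed
  qed
  ultimately have "variety_iso ?V ?P f" using gf fg by (rule variety_isoI)
  then show ?thesis by (rule isomorphic_varietiesI)
qed

lemma regular_map_source:
  assumes "words w \<noteq> []"
    and "\<And>P. P \<in> points (closed_correspondence n w \<pi>) \<Longrightarrow> source_map P \<in> points (braid_variety n (words w ! 0) \<pi>)"
  shows "regular_map (closed_correspondence n w \<pi>) (braid_variety n (words w ! 0) \<pi>) source_map"
  using regular_list_nth[OF regular_list_correspondence[of 0 w n \<pi>]] assms
  by (intro regular_mapI) (auto simp: braid_variety_def source_map_def case_prod_beta')

lemma regular_list_braid_variety: "regular_list (braid_variety n \<beta> \<pi>) (length \<beta>) (\<lambda>z. z)"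
  by (rule regular_listI) (auto simp: braid_variety_def intro!: regular_function_coord)

lemma closed_correspondence_Nil_isomorphic:
  "closed_correspondence n \<lparr>words = [\<beta>], steps = []\<rparr> \<pi> \<cong>\<^sub>v prod_variety (braid_variety n \<beta> \<pi>) (affine_torus 0 0)"
proof -
  let ?V = "closed_correspondence n \<lparr>words = [\<beta>], steps = []\<rparr> \<pi>"
    and ?P = "prod_variety (braid_variety n \<beta> \<pi>) (affine_torus 0 0)"
  have V: "P \<in> points ?V \<longleftrightarrow> (\<exists>z \<in> points (braid_variety n \<beta> \<pi>). P = ([z], []))" for P
    by (cases P) (auto simp: closed_correspondence_def correspondence_def correspondence_points_def
        braid_variety_def target_map_def length_Suc_conv)
  have "regular_map ?V ?P (\<lambda>P. (source_map P, ([], [])))"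
  proof (rule regular_map_Pair)
    show "regular_map ?V (braid_variety n \<beta> \<pi>) source_map"
    proof -
      have "source_map P \<in> points (braid_variety n \<beta> \<pi>)" if "P \<in> points ?V" for P
        using that V by (auto simp: source_map_def)
      then show ?thesis using regular_map_source[of "\<lparr>words = [\<beta>], steps = []\<rparr>" n \<pi>] by simp
    qed
    show "regular_map ?V (affine_torus 0 0) (\<lambda>P. ([], []))"
      by (rule regular_map_affine_torus) (auto simp: regular_list_Nil)
  qed
  moreover have "regular_map ?P ?V (\<lambda>p. ([fst p], []))"
  proof (rule regular_map_closed_correspondence)
    fix j k assume "j < length (words \<lparr>words = [\<beta>], steps = []\<rparr>)" "k < length (words \<lparr>words = [\<beta>], steps = []\<rparr> ! j)"
    then show "regular_function ?P (\<lambda>p. fst ([fst p], []) ! j ! k)"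
      using regular_list_nth[OF regular_list_comp[OF regular_map_fst regular_list_braid_variety], of k]
      by simp
  qed (use V in auto)
  ultimately have "variety_iso ?V ?P (\<lambda>P. (source_map P, ([], [])))"
    by (rule variety_isoI) (auto simp: V points_affine_torus source_map_def)
  then show ?thesis by (rule isomorphic_varietiesI)
qed

text \<open>
  Induction on the number of steps, starting from the braid variety of the target word.
\<close>

theorem closed_correspondence_isomorphic:
  assumes "is_weave n \<gamma> \<beta> w" "num_caps w = 0"
  shows "closed_correspondence n w \<pi> \<cong>\<^sub>v
    prod_variety (braid_variety n \<beta> \<pi>) (affine_torus (num_cups w) (num_trivalent w))"
proof -
  obtain ws S where w: "w = \<lparr>words = ws, steps = S\<rparr>" by (cases w) auto
  show ?thesis
    using assms unfolding w
  proof (induction S arbitrary: \<gamma> ws)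
    case Nil
    then show ?case
      using closed_correspondence_Nil_isomorphic by (auto simp: num_cups_def num_trivalent_def elim!: is_weave_NilE)
  next
    case (Cons s S)
    obtain W l v r where step: "ws = \<gamma> # W" "s = (length l, v)" "valid_move v"
      "\<gamma> = l @ move_source v @ r" "braid_word n \<gamma>"
      "length W = Suc (length S)" "W ! 0 = l @ move_target v @ r"
      "is_weave n (l @ move_target v @ r) \<beta> \<lparr>words = W, steps = S\<rparr>"
      using is_weave_ConsE[OF Cons.prems(1)] by blast
    have cap: "\<not> is_Cap v" and caps: "num_caps \<lparr>words = W, steps = S\<rparr> = 0"
      using Cons.prems(2) step(2) by (auto simp: num_caps_def split: if_splits)
    let ?w = "\<lparr>words = ws, steps = s # S\<rparr>" and ?w' = "\<lparr>words = W, steps = S\<rparr>"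
    let ?X = "braid_variety n \<beta> \<pi>"
    have "closed_correspondence n ?w \<pi> \<cong>\<^sub>v prod_variety (closed_correspondence n ?w' \<pi>) (move_params v)"
      using closed_correspondence_Cons_isomorphic[OF step(4,5,3) cap step(6,7), of \<pi>]
        step(1,2) by simp
    also have "prod_variety (closed_correspondence n ?w' \<pi>) (move_params v) \<cong>\<^sub>v
        prod_variety (prod_variety ?X (affine_torus (num_cups ?w') (num_trivalent ?w'))) (move_params v)"
      by (rule isomorphic_prod_left[OF Cons.IH[OF step(8) caps]])
    also have "prod_variety (prod_variety ?X (affine_torus (num_cups ?w') (num_trivalent ?w'))) (move_params v) \<cong>\<^sub>v
        prod_variety ?X (affine_torus (num_cups ?w) (num_trivalent ?w))"
    proof (rule isomorphic_varieties_sym)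
      have "num_cups ?w = num_cups ?w' + (if is_Cup v then 1 else 0)"
        "num_trivalent ?w = num_trivalent ?w' + (if is_Trivalent v then 1 else 0)"
        using step(2) by (auto simp: num_cups_def num_trivalent_def)
      then show "prod_variety ?X (affine_torus (num_cups ?w) (num_trivalent ?w)) \<cong>\<^sub>v
          prod_variety (prod_variety ?X (affine_torus (num_cups ?w') (num_trivalent ?w'))) (move_params v)"
        using affine_torus_prod unfolding isomorphic_varieties_def move_params_def by metis
    qed
    finally show ?case .
  qed
qed

lemma weave_length:
  assumes "is_weave n \<gamma> \<beta> w" "num_caps w = 0"
  shows "length \<gamma> = length \<beta> + 2 * num_cups w + num_trivalent w"
proof -
  obtain ws S where w: "w = \<lparr>words = ws, steps = S\<rparr>" by (cases w) auto
  show ?thesis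
    using assms unfolding w
  proof (induction S arbitrary: \<gamma> ws)
    case Nil
    then show ?case by (auto simp: num_cups_def num_trivalent_def elim!: is_weave_NilE)
  next
    case (Cons s S)
    obtain W l v r where step: "ws = \<gamma> # W" "s = (length l, v)" "valid_move v"
      "\<gamma> = l @ move_source v @ r" "braid_word n \<gamma>"
      "length W = Suc (length S)" "W ! 0 = l @ move_target v @ r"
      "is_weave n (l @ move_target v @ r) \<beta> \<lparr>words = W, steps = S\<rparr>"
      using is_weave_ConsE[OF Cons.prems(1)] by blast
    have cap: "\<not> is_Cap v" and caps: "num_caps \<lparr>words = W, steps = S\<rparr> = 0"
      using Cons.prems(2) step(2) by (auto simp: num_caps_def split: if_splits)
    show ?case
      using Cons.IH[OF step(8) caps] step(2,4) cap
      by (cases v) (auto simp: num_cups_def num_trivalent_def)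
  qed
qed

lemma source_map_braid_variety:
  assumes "is_weave n \<gamma> \<beta> w" "num_caps w = 0"
    and "P \<in> points (closed_correspondence n w \<pi>)"
  shows "source_map P \<in> points (braid_variety n \<gamma> \<pi>)"
proof -
  obtain ws S where w: "w = \<lparr>words = ws, steps = S\<rparr>" by (cases w) auto
  show ?thesis
    using assms unfolding w
  proof (induction S arbitrary: \<gamma> ws P)
    case Nil
    then show ?case
      by (auto simp: closed_correspondence_def correspondence_def correspondence_points_def
          source_map_def target_map_def braid_variety_def elim!: is_weave_NilE)
  next
    case (Cons s S)
    obtain W l v r where step: "ws = \<gamma> # W" "s = (length l, v)" "valid_move v"
      "\<gamma> = l @ move_source v @ r" "braid_word n \<gamma>"
      "length W = Suc (length S)" "W ! 0 = l @ move_target v @ r"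
      "is_weave n (l @ move_target v @ r) \<beta> \<lparr>words = W, steps = S\<rparr>"
      using is_weave_ConsE[OF Cons.prems(1)] by blast
    have cap: "\<not> is_Cap v" and caps: "num_caps \<lparr>words = W, steps = S\<rparr> = 0"
      using Cons.prems(2) step(2) by (auto simp: num_caps_def split: if_splits)
    obtain z zs U Us where P: "P = (z # zs, U # Us)" "length z = length \<gamma>" "length (zs ! 0) = length (W ! 0)"
      "step_relation n \<gamma> s z (zs ! 0) U" "(zs, Us) \<in> points (closed_correspondence n \<lparr>words = W, steps = S\<rparr> \<pi>)"
      using Cons.prems(3) closed_correspondence_points_Cons[OF step(6), of "fst P" "snd P" n \<gamma> s \<pi>] step(1)
      by (cases P) auto
    let ?M = "braid_mat n (l @ move_target v @ r) (zs ! 0)" and ?p = "perm_mat n \<pi>"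
    have "upper_triangular (?M * ?p)"
      using Cons.IH[OF step(8) caps P(5)] by (simp add: source_map_def braid_variety_def)
    moreover obtain V where V: "V \<in> borel_subgroup n" "braid_mat n \<gamma> z = V * ?M"
      using step_relation_braid_mat[OF cap, of z l r "zs ! 0" n U] P step by metis
    have carrier: "?M \<in> carrier_mat n n" "?p \<in> carrier_mat n n" "V \<in> carrier_mat n n"
      using P(3) step(7) V(1) by (auto simp: perm_mat_def borel_subgroup_iff)
    ultimately have "upper_triangular (V * (?M * ?p))"
      using upper_triangular_mult[of V n "?M * ?p"] V(1) by (simp add: borel_subgroup_iff)
    then have "upper_triangular (braid_mat n \<gamma> z * ?p)"
      using V(2) carrier by (simp add: assoc_mult_mat[of _ n n _ n _ n])
    then show ?case using P by (simp add: source_map_def braid_variety_def)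
  qed
qed

text \<open>
  All steps are deterministic in the forward direction, so the source variables propagate through the whole
  weave.
\<close>

lemma inj_on_source_map:
  assumes "is_weave n \<gamma> \<beta> w" "num_caps w = 0"
  shows "inj_on source_map (points (correspondence n w))"
proof -
  obtain ws S where w: "w = \<lparr>words = ws, steps = S\<rparr>" by (cases w) auto
  have "P = Q" if "P \<in> correspondence_points n w" "Q \<in> correspondence_points n w" "source_map P = source_map Q" for P Q
    using assms that unfolding w
  proof (induction S arbitrary: \<gamma> ws P Q)
    case Nil
    then show ?case
      by (cases P; cases Q) (auto simp: correspondence_points_def source_map_def length_Suc_conv elim!: is_weave_NilE)
  next
    case (Cons s S)
    obtain W l v r where step: "ws = \<gamma> # W" "s = (length l, v)" "valid_move v"
      "\<gamma> = l @ move_source v @ r" "braid_word n \<gamma>"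
      "length W = Suc (length S)" "W ! 0 = l @ move_target v @ r"
      "is_weave n (l @ move_target v @ r) \<beta> \<lparr>words = W, steps = S\<rparr>"
      using is_weave_ConsE[OF Cons.prems(1)] by blast
    have cap: "\<not> is_Cap v" and caps: "num_caps \<lparr>words = W, steps = S\<rparr> = 0"
      using Cons.prems(2) step(2) by (auto simp: num_caps_def split: if_splits)
    note Cons' = correspondence_points_Cons[OF step(6), of _ _ n \<gamma> s, folded step(1)]
    obtain z zs U Us where P: "P = (z # zs, U # Us)" "length z = length \<gamma>" "length (zs ! 0) = length (W ! 0)"
      "step_relation n \<gamma> s z (zs ! 0) U" "(zs, Us) \<in> correspondence_points n \<lparr>words = W, steps = S\<rparr>"
      using Cons.prems(3) Cons'[of "fst P" "snd P"] by (cases P) auto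
    obtain z' zs' U' Us' where Q: "Q = (z' # zs', U' # Us')" "length z' = length \<gamma>" "length (zs' ! 0) = length (W ! 0)"
      "step_relation n \<gamma> s z' (zs' ! 0) U'" "(zs', Us') \<in> correspondence_points n \<lparr>words = W, steps = S\<rparr>"
      using Cons.prems(4) Cons'[of "fst Q" "snd Q"] by (cases Q) auto
    have z: "z = z'" using Cons.prems(5) P(1) Q(1) by (simp add: source_map_def)
    then have "zs ! 0 = zs' ! 0 \<and> U = U'"
      using step_relation_forward_unique[OF cap step(3) step(5)[unfolded step(4)], of z "zs ! 0" "zs' ! 0" U U']
        P(2-4) Q(2-4) step(2,4,7) by simp
    then show ?case
      using Cons.IH[OF step(8) caps P(5) Q(5)] z P(1) Q(1) by (simp add: source_map_def)
  qed
  then show ?thesis by (auto simp: inj_on_def correspondence_def)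
qed

theorem corollary1p4:
  fixes n a b :: nat and \<gamma> :: "nat list" and w :: weave
  assumes "1 \<le> n"
    and "braid_word n \<gamma>"
    and "is_weave n \<gamma> (half_twist n) w"
    and "num_caps w = 0"
    and "num_cups w = a"
    and "num_trivalent w = b"
  shows "(\<exists>\<phi>. variety_iso (affine_torus a b) (closed_correspondence n w (longest_perm n)) \<phi> \<and>
             regular_map (affine_torus a b) (braid_variety n \<gamma> (longest_perm n)) (source_map \<circ> \<phi>) \<and>
             inj_on (source_map \<circ> \<phi>) (points (affine_torus a b))) \<and>
         2 * int a + int b = int (length \<gamma>) - int (n choose 2)"
proof
  let ?V = "closed_correspondence n w (longest_perm n)"
  have "?V \<cong>\<^sub>v affine_torus a b"
    using isomorphic_varieties_trans[OF closed_correspondence_isomorphic[OF assms(3,4)]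
        isomorphic_prod_point[OF points_braid_variety_half_twist]] assms(5,6) by simp
  then obtain \<phi> where \<phi>: "variety_iso (affine_torus a b) ?V \<phi>"
    using isomorphic_varieties_sym by (auto simp: isomorphic_varieties_def)
  then obtain \<psi> where reg: "regular_map (affine_torus a b) ?V \<phi>"
    and \<psi>: "\<And>x. x \<in> points (affine_torus a b) \<Longrightarrow> \<psi> (\<phi> x) = x"
    by (auto simp: variety_iso_def)
  have w: "words w \<noteq> []" "words w ! 0 = \<gamma>" using assms(3) by (auto simp: is_weave_def)
  have "regular_map ?V (braid_variety n \<gamma> (longest_perm n)) source_map"
    using regular_map_source[OF w(1), of n "longest_perm n"]
      source_map_braid_variety[OF assms(3,4)] w(2) by simp
  then have "regular_map (affine_torus a b) (braid_variety n \<gamma> (longest_perm n)) (source_map \<circ> \<phi>)"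
    by (rule regular_map_comp[OF reg])
  moreover have "inj_on (source_map \<circ> \<phi>) (points (affine_torus a b))"
  proof (rule comp_inj_on)
    show "inj_on \<phi> (points (affine_torus a b))" using \<psi> by (rule inj_on_inverseI)
    have "\<phi> ` points (affine_torus a b) \<subseteq> points (correspondence n w)"
      using reg by (auto simp: regular_map_def closed_correspondence_def)
    then show "inj_on source_map (\<phi> ` points (affine_torus a b))"
      by (rule inj_on_subset[OF inj_on_source_map[OF assms(3,4)]])
  qed
  ultimately show "\<exists>\<phi>. variety_iso (affine_torus a b) ?V \<phi> \<and>
      regular_map (affine_torus a b) (braid_variety n \<gamma> (longest_perm n)) (source_map \<circ> \<phi>) \<and>
      inj_on (source_map \<circ> \<phi>) (points (affine_torus a b))"
    using \<phi> by blast
  show "2 * int a + int b = int (length \<gamma>) - int (n choose 2)"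
    using weave_length[OF assms(3,4)] assms(5,6) by (simp add: length_half_twist)
qed

end
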